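(* Let $T>0$, $A\ge 0$, and let $b(y,s)$, $y\in\mathbb{R}$, $s\le T$, be a real-valued function, differentiable in $y$ with $\partial b/\partial y$ continuous in $(y,s)$, satisfying $\sup\{|\partial b(y,s)/\partial y| : y\in\mathbb{R},\ s\le T\}\le A$. Suppose that $b(y,s)$ is concave in $y$ for $y\in\mathbb{R}$, $s\in[t,T]$, where $t<T$. Then the minimizer $y(\cdot)\in E_{x,y,t}$ of the variational problem defining $q(x,y,t)$ is unique for all $(x,y)\in\mathbb{R}^2$. Furthermore (with the concavity hypothesis holding for every $t<T$), the function $q(x,y,t)$ is $C^1$ in $(x,y,t)$ for $(x,y)\in\mathbb{R}^2$, $t<T$.
   Context: For $x,y\in\mathbb{R}$ and $t<T$, $E_{x,y,t}$ is the set of functions $y(s)=y+\int_t^s f(s')\,ds'$, $t\le s\le T$, with $f\in L^2[t,T]$ and $y(T)\ge x$. The function $q$ is $$q(x,y,t)=\min_{y(\cdot)\in E_{x,y,t}}\ \tfrac12\int_t^T\left[\tfrac{dy(s)}{ds}-b(y(s),s)\right]^2ds .$$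
   Formalization: The function b(y,s) itself is additionally assumed jointly continuous in (y,s) for s ≤ T; without this, q need not be C^1 in t (e.g. b(y,s)=1 for s ≥ 0 and 0 for s < 0). *)

theory Defs
  imports "HOL-Analysis.Analysis"
begin

definition square_integrable_on :: "real set \<Rightarrow> (real \<Rightarrow> real) \<Rightarrow> bool" where
  "square_integrable_on S f \<longleftrightarrow>
     set_borel_measurable lebesgue S f \<and> set_integrable lebesgue S (\<lambda>s. (f s)\<^sup>2)"

text \<open>Paths are functions on the interval from \<open>t\<close> to \<open>T\<close>. They are represented as total functions
  with the value \<open>undefined\<close> outside it, so that equality of paths is equality on the interval.\<close>

definition admissible_paths :: "real \<Rightarrow> real \<Rightarrow> real \<Rightarrow> real \<Rightarrow> (real \<Rightarrow> real) set" where
  "admissible_paths T x y t =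
     {\<gamma>. \<gamma> T \<ge> x \<and>
        (\<exists>f. square_integrable_on {t..T} f \<and>
             \<gamma> = (\<lambda>s\<in>{t..T}. y + (LINT r:{t..s}|lebesgue. f r)))}"

text \<open>For an admissible path with density \<open>f\<close>, the derivative exists and equals \<open>f\<close> almost
  everywhere on the interval; the value of \<^const>\<open>deriv\<close> on the remaining null set is immaterial.\<close>

definition action :: "(real \<Rightarrow> real \<Rightarrow> real) \<Rightarrow> real \<Rightarrow> real \<Rightarrow> (real \<Rightarrow> real) \<Rightarrow> real" where
  "action b T t \<gamma> = 1/2 * (LINT s:{t..T}|lebesgue. (deriv \<gamma> s - b (\<gamma> s) s)\<^sup>2)"

text \<open>The minimum value is written as an infimum; it is a minimum whenever a minimizer exists.\<close>

definition q :: "(real \<Rightarrow> real \<Rightarrow> real) \<Rightarrow> real \<Rightarrow> real \<Rightarrow> real \<Rightarrow> real \<Rightarrow> real" where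
  "q b T x y t = (INF \<gamma>\<in>admissible_paths T x y t. action b T t \<gamma>)"

definition is_minimizer ::
  "(real \<Rightarrow> real \<Rightarrow> real) \<Rightarrow> real \<Rightarrow> real \<Rightarrow> real \<Rightarrow> real \<Rightarrow> (real \<Rightarrow> real) \<Rightarrow> bool" where
  "is_minimizer b T x y t \<gamma> \<longleftrightarrow> is_arg_min (action b T t) (\<lambda>\<eta>. \<eta> \<in> admissible_paths T x y t) \<gamma>"

text \<open>Continuous differentiability, meant for open \<open>S\<close>; the derivative is continuous in operator
  norm.\<close>

definition C1_on :: "'a::real_normed_vector set \<Rightarrow> ('a \<Rightarrow> 'b::real_normed_vector) \<Rightarrow> bool" where
  "C1_on S f \<longleftrightarrow>
     (\<exists>f' :: 'a \<Rightarrow> 'a \<Rightarrow>\<^sub>L 'b.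
        (\<forall>p\<in>S. (f has_derivative blinfun_apply (f' p)) (at p)) \<and> continuous_on S f')"

end

theory Submission
  imports Defs
begin

text \<open>
The control of a path \<open>y(\<cdot>)\<close> is its deviation from the drift, \<open>u(s) = y'(s) - b(y(s), s)\<close>. A path
starting at \<open>y\<close> and its control determine each other, because \<open>z' = b(z, s) + u(s)\<close> is uniquely
solvable for square integrable \<open>u\<close>, and the action of the path is the energy \<open>\<integral>u\<^sup>2/2\<close> of the control
(\<open>admissible_paths_iff\<close>, \<open>action_trajectory\<close>). The problem is thus to find the element of least norm
among the controls that steer \<open>y\<close> to the right of \<open>x\<close>.

Concavity makes the set of these controls convex, jointly with \<open>(x, y)\<close>. A convex combination of two
paths follows the combined control \<^emph>\<open>minus\<close> the concavity gap of \<open>b\<close>, so by comparison the path that is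
driven by the combined control itself ends at least as far to the right (\<open>steers_mix\<close>). Hence the
parallelogram identity applies as in the projection theorem for Hilbert spaces: minimizing sequences
are Cauchy in \<open>L\<^sup>2\<close>, their limit is optimal, and the optimum is unique (\<open>minimizer_unique\<close>). By the
same inclusion \<open>q\<close> is convex in \<open>(x, y)\<close>.

Convexity supplies most of the regularity of \<open>q\<close>. Perturbing the optimal path by a multiple of an
affine function gives a differentiable function that touches \<open>q\<close> from above, and a convex function
touched in this way is differentiable; so \<open>q\<^sub>x\<close> and \<open>q\<^sub>y\<close> exist (\<open>Q_differentiable_on_line\<close>). In time,
dynamic programming over a short interval \<open>[t\<^sub>1, t\<^sub>2]\<close> bounds \<open>q(x, y, t\<^sub>1)\<close> from above by the cost of
moving at a constant speed \<open>v\<close> (\<open>Q_le_delayed_start\<close>), and from below by restarting the optimal path at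
\<open>t\<^sub>2\<close> and using the tangent of the convex function \<open>q(x, \<cdot>, t\<^sub>2)\<close> (\<open>Q_ge_delayed_start\<close>). Crude forms of
both bounds show that \<open>q\<close> is continuous in \<open>t\<close>. Convexity turns this into joint continuity of \<open>q\<close>, and
then of \<open>q\<^sub>x\<close> and \<open>q\<^sub>y\<close>. Finally, with the optimal speed \<open>v = b - q\<^sub>y\<close>, both bounds have the same limit and
prove the Hamilton-Jacobi equation \<open>q\<^sub>t = q\<^sub>y\<^sup>2/2 - b q\<^sub>y\<close>, whose right-hand side is continuous.
\<close>

section \<open>Differentiating an indefinite integral\<close>

text \<open>At a point \<open>x\<close> of this set there are arbitrarily short intervals with endpoint \<open>x\<close> on which the
  integral differs from \<open>(y - x) f(x)\<close> by more than \<open>e\<close> times the length. Vitali's theorem selects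
  disjoint ones that cover the set up to a null set. By Henstock's lemma their errors add up to at most
  \<open>e \<eta>\<close>, so their total length is at most \<open>\<eta>\<close>.\<close>

lemma negligible_indefinite_integral_error:
  fixes f :: "real \<Rightarrow> real"
  assumes f: "f integrable_on {a..b}" and e: "e > 0"
  defines "F \<equiv> \<lambda>s. integral {a..s} f"
  shows "negligible {x \<in> {a<..<b}. \<forall>\<delta>>0. \<exists>y\<in>{a..b}. y \<noteq> x \<and> \<bar>y - x\<bar> < \<delta> \<and>
           \<bar>F y - F x - (y - x) * f x\<bar> > e * \<bar>y - x\<bar>}" (is "negligible ?S")
  unfolding negligible_outer_le
proof (intro allI impI)
  fix \<eta> :: real assume \<eta>: "\<eta> > 0"
  have f': "f integrable_on cbox a b" using f by simp
  obtain \<gamma> where gau: "gauge \<gamma>" and fine: "\<And>p. \<lbrakk>p tagged_partial_division_of (cbox a b); \<gamma> fine p\<rbrakk> \<Longrightarrow>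
             sum (\<lambda>(x,k). norm(measure lborel k *\<^sub>R f x - integral k f)) p < e * \<eta>"
    using Henstock_lemma[OF f', of "e * \<eta>"] e \<eta> by (auto simp: mult_pos_pos)
  \<comment> \<open>An index \<open>(x, y)\<close> stands for the interval between its tag \<open>x\<close> and \<open>y\<close>.\<close>
  define I where "I = (\<lambda>(x::real,y::real). {min x y..max x y})"
  define K where "K = {(x,y). x \<in> {a<..<b} \<and> y \<in> {a..b} \<and> y \<noteq> x \<and> I (x,y) \<subseteq> \<gamma> x \<and>
     \<bar>F y - F x - (y - x) * f x\<bar> > e * \<bar>y - x\<bar>}"
  define c where "c = (\<lambda>(x::real,y::real). (x + y)/2)"
  define r where "r = (\<lambda>(x::real,y::real). \<bar>y - x\<bar>/2)"
  have ball: "cball (c i) (r i) = I i" for i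
    by (cases i) (auto simp: c_def r_def I_def cball_eq_atLeastAtMost abs_if field_simps min_def max_def)
  have r0: "0 < r i" if "i \<in> K" for i using that by (auto simp: K_def r_def)
  have cov: "\<exists>i. i \<in> K \<and> x \<in> cball (c i) (r i) \<and> r i < d" if x: "x \<in> ?S" and d: "0 < d" for x d
  proof -
    have "open (\<gamma> x)" "x \<in> \<gamma> x" using gau by (auto simp: gauge_def)
    then obtain \<rho> where \<rho>: "\<rho> > 0" "ball x \<rho> \<subseteq> \<gamma> x" using openE by blast
    obtain y where y: "y \<in> {a..b}" "y \<noteq> x" "\<bar>y - x\<bar> < min d \<rho>" "\<bar>F y - F x - (y - x) * f x\<bar> > e * \<bar>y - x\<bar>"
      using x d \<rho> by (fastforce dest: spec[of _ "min d \<rho>"])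
    have "I (x,y) \<subseteq> ball x \<rho>" using y(3) by (auto simp: I_def dist_real_def min_def max_def abs_if split: if_splits)
    then have "(x,y) \<in> K" using y x \<rho> by (auto simp: K_def)
    moreover have "x \<in> cball (c (x,y)) (r (x,y))" unfolding ball by (auto simp: I_def)
    moreover have "r (x,y) < d" using y(3) by (auto simp: r_def)
    ultimately show ?thesis by blast
  qed
  obtain C where C: "countable C" "C \<subseteq> K"
     "pairwise (\<lambda>i j. disjnt (I i) (I j)) C" "negligible(?S - (\<Union>i \<in> C. I i))"
    using Vitali_covering_theorem_cballs[of K r ?S c, OF r0 cov] unfolding ball by blast
  have meas: "I i \<in> lmeasurable" for i by (cases i) (auto simp: I_def)
  have bnd: "measure lebesgue (\<Union>i\<in>D. I i) \<le> \<eta>" if D: "D \<subseteq> C" "finite D" for D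
  proof -
    define p where "p = (\<lambda>i. (fst i, I i)) ` D"
    have DK: "D \<subseteq> K" using D C by auto
    have disj: "I i \<inter> I j = {}" if "i \<in> D" "j \<in> D" "i \<noteq> j" for i j
      using C(3) D(1) that unfolding pairwise_def disjnt_def by blast
    have inj: "inj_on (\<lambda>i. (fst i, I i)) D"
    proof (rule inj_onI)
      fix i j assume ij: "i \<in> D" "j \<in> D" "(fst i, I i) = (fst j, I j)"
      have "fst i \<in> I i" by (cases i) (auto simp: I_def)
      then show "i = j" using disj[of i j] ij by auto
    qed
    have "p tagged_partial_division_of (cbox a b)"
      unfolding tagged_partial_division_of_def
    proof (intro conjI allI impI)
      show "finite p" using D by (auto simp: p_def)
      fix x k assume "(x,k) \<in> p"
      then obtain y where y: "(x,y) \<in> D" "k = I (x,y)" by (auto simp: p_def)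
      then have "(x,y) \<in> K" using DK by auto
      then show "x \<in> k" "k \<subseteq> cbox a b" "\<exists>a b. k = cbox a b"
        unfolding y(2) by (auto simp: I_def K_def box_real[symmetric] simp del: box_real)
    next
      fix x1 K1 x2 K2 assume "(x1,K1) \<in> p \<and> (x2,K2) \<in> p \<and> (x1,K1) \<noteq> (x2,K2)"
      then obtain i j where "i \<in> D" "j \<in> D" "i \<noteq> j" "K1 = I i" "K2 = I j" by (auto simp: p_def)
      then show "interior K1 \<inter> interior K2 = {}" using disj[of i j] interior_subset by blast
    qed
    moreover have "\<gamma> fine p" unfolding fine_def
    proof clarify
      fix x k z assume "(x,k) \<in> p" "z \<in> k"
      then obtain y where y: "(x,y) \<in> D" "k = I (x,y)" by (auto simp: p_def)
      then have "(x,y) \<in> K" using DK by blast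
      then have "I (x,y) \<subseteq> \<gamma> x" unfolding K_def by simp
      then show "z \<in> \<gamma> x" using y \<open>z \<in> k\<close> by blast
    qed
    ultimately have S: "sum (\<lambda>(x,k). norm(measure lborel k *\<^sub>R f x - integral k f)) p < e * \<eta>" by (rule fine)
    have tagged_error: "e * measure lebesgue (I i) \<le> norm (measure lborel (I i) *\<^sub>R f (fst i) - integral (I i) f)" if "i \<in> D" for i
    proof -
      obtain x y where i: "i = (x,y)" by (cases i)
      have K: "(x,y) \<in> K" using that DK i by auto
      have xy: "x \<in> {a..b}" "y \<in> {a..b}" "\<bar>F y - F x - (y - x) * f x\<bar> > e * \<bar>y - x\<bar>"
        using K by (auto simp: K_def)
      have comb: "integral {u..v} f = F v - F u" if "u \<le> v" "a \<le> u" "v \<le> b" for u v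
        using Henstock_Kurzweil_Integration.integral_combine[of a u v f] that
          integrable_subinterval_real[OF f, of a v] by (auto simp: F_def)
      have "measure lebesgue (I i) = \<bar>y - x\<bar>" "measure lborel (I i) = \<bar>y - x\<bar>"
        by (auto simp: I_def i min_def max_def)
      moreover have "\<bar>F y - F x - (y - x) * f x\<bar> = norm (\<bar>y-x\<bar> *\<^sub>R f (fst i) - integral (I i) f)"
        using xy comb[of x y] comb[of y x] by (cases "x \<le> y") (auto simp: I_def i abs_if min_def max_def algebra_simps)
      ultimately show ?thesis using xy(3) by simp
    qed
    have "e * measure lebesgue (\<Union>i\<in>D. I i) \<le> e * (\<Sum>i\<in>D. measure lebesgue (I i))"
      using e D meas by (intro mult_left_mono measure_UNION_le) auto
    also have "\<dots> = (\<Sum>i\<in>D. e * measure lebesgue (I i))" by (simp add: sum_distrib_left)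
    also have "\<dots> \<le> (\<Sum>i\<in>D. norm (measure lborel (I i) *\<^sub>R f (fst i) - integral (I i) f))"
      by (intro sum_mono tagged_error)
    also have "\<dots> = sum (\<lambda>(x,k). norm(measure lborel k *\<^sub>R f x - integral k f)) p"
      unfolding p_def by (subst sum.reindex[OF inj]) auto
    finally show ?thesis using S e by (smt (verit) mult_less_cancel_left_pos)
  qed
  have W: "(\<Union>i\<in>C. I i) \<in> lmeasurable" "measure lebesgue (\<Union>i\<in>C. I i) \<le> \<eta>"
    using fmeasurable_UN_bound[of C I lebesgue \<eta>] C(1) meas bnd measure_UN_bound[of C I lebesgue \<eta>] by auto
  show "\<exists>T. ?S \<subseteq> T \<and> T \<in> lmeasurable \<and> measure lebesgue T \<le> \<eta>"
  proof (intro exI conjI)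
    let ?W = "\<Union>i\<in>C. I i"
    show "?S \<subseteq> ?W \<union> (?S - ?W)" by auto
    show "?W \<union> (?S - ?W) \<in> lmeasurable" by (rule fmeasurable.Un[OF W(1) negligible_imp_measurable[OF C(4)]])
    have "measure lebesgue (?W \<union> (?S - ?W)) \<le> measure lebesgue ?W + measure lebesgue (?S - ?W)"
      using fmeasurableD[OF W(1)] negligible_imp_sets[OF C(4)] by (rule measure_Un_le)
    then show "measure lebesgue (?W \<union> (?S - ?W)) \<le> \<eta>" using W(2) negligible_imp_measure0[OF C(4)] by linarith
  qed
qed

text \<open>Lebesgue's differentiation theorem on the line. It identifies the derivative in the action of an
  admissible path with the density of the path.\<close>

theorem indefinite_integral_has_derivative_ae:
  fixes f :: "real \<Rightarrow> real"
  assumes f: "f integrable_on {a..b}"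
  shows "negligible {x \<in> {a<..<b}. \<not> ((\<lambda>s. integral {a..s} f) has_real_derivative f x) (at x)}"
proof -
  let ?F = "\<lambda>s. integral {a..s} f"
  define S where "S = (\<lambda>e. {x \<in> {a<..<b}. \<forall>\<delta>>0. \<exists>y\<in>{a..b}. y \<noteq> x \<and> \<bar>y - x\<bar> < \<delta> \<and>
           \<bar>?F y - ?F x - (y - x) * f x\<bar> > e * \<bar>y - x\<bar>})"
  have "negligible (\<Union>n. S (1 / real (Suc n)))"
    unfolding S_def by (rule negligible_Union_nat, rule negligible_indefinite_integral_error[OF f]) simp
  moreover have "{x \<in> {a<..<b}. \<not> (?F has_real_derivative f x) (at x)} \<subseteq> (\<Union>n. S (1 / real (Suc n)))"
  proof (rule subsetI, rule ccontr)
    fix x assume bad: "x \<in> {x \<in> {a<..<b}. \<not> (?F has_real_derivative f x) (at x)}"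
      and x2: "x \<notin> (\<Union>n. S (1 / real (Suc n)))"
    then have x: "x \<in> {a<..<b}" "x \<notin> (\<Union>n. S (1 / real (Suc n)))" by auto
    have "\<forall>\<^sub>F y in at x. y \<in> {a<..<b}"
      using x(1) by (intro eventually_at_in_open') auto
    then have ab: "\<forall>\<^sub>F y in at x. y \<in> {a..b}"
      by (rule eventually_mono) simp
    have "\<forall>\<^sub>F y in at x. \<bar>(?F y - ?F x) / (y - x) - f x\<bar> < e" if "e > 0" for e
    proof -
      obtain n where n: "1 / real (Suc n) < e" using \<open>e > 0\<close> nat_approx_posE by blast
      have "x \<notin> S (1 / real (Suc n))" using x(2) by blast
      then obtain \<delta> where "\<delta> > 0" and \<delta>': "\<not> (\<exists>y\<in>{a..b}. y \<noteq> x \<and> \<bar>y - x\<bar> < \<delta> \<and>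
          \<bar>?F y - ?F x - (y - x) * f x\<bar> > 1 / real (Suc n) * \<bar>y - x\<bar>)"
        using x(1) unfolding S_def mem_Collect_eq by blast
      have \<delta>: "\<bar>?F y - ?F x - (y - x) * f x\<bar> \<le> 1 / real (Suc n) * \<bar>y - x\<bar>"
        if "y \<in> {a..b}" "y \<noteq> x" "\<bar>y - x\<bar> < \<delta>" for y
        using \<delta>' that not_less by blast
      have "\<forall>\<^sub>F y in at x. \<bar>y - x\<bar> < \<delta> \<and> y \<noteq> x" 
        unfolding eventually_at dist_real_def using \<open>\<delta> > 0\<close> by blast
      with ab show ?thesis
      proof eventually_elim
        case (elim y)
        have "(?F y - ?F x) / (y - x) - f x = (?F y - ?F x - (y - x) * f x) / (y - x)"
          using elim by (simp add: field_simps)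
        then have "\<bar>(?F y - ?F x) / (y - x) - f x\<bar> * \<bar>y - x\<bar> = \<bar>?F y - ?F x - (y - x) * f x\<bar>"
          using elim by (simp only: abs_divide) simp
        then have "\<bar>(?F y - ?F x) / (y - x) - f x\<bar> * \<bar>y - x\<bar> \<le> 1 / real (Suc n) * \<bar>y - x\<bar>"
          using \<delta>[of y] elim by auto
        moreover have "\<bar>y - x\<bar> > 0" using elim by auto
        ultimately have "\<bar>(?F y - ?F x) / (y - x) - f x\<bar> \<le> 1 / real (Suc n)" using mult_right_le_imp_le by blast
        then show ?case using n by linarith
      qed
    qed
    then have "((\<lambda>y. (?F y - ?F x) / (y - x)) \<longlongrightarrow> f x) (at x)" by (auto simp: tendsto_iff dist_real_def)
    then have "(?F has_real_derivative f x) (at x)" by (simp add: has_field_derivative_iff)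
    then show False using bad by blast
  qed
  ultimately show ?thesis using negligible_subset by blast
qed

section \<open>Square integrable functions on an interval\<close>

lemma square_integrable_on_iff:
  "square_integrable_on {a..b} f \<longleftrightarrow>
     f \<in> borel_measurable (lebesgue_on {a..b}) \<and> (\<lambda>s. (f s)\<^sup>2) integrable_on {a..b}"
proof -
  have "set_borel_measurable lebesgue {a..b} f \<longleftrightarrow> f \<in> borel_measurable (lebesgue_on {a..b})"
    by (simp add: set_borel_measurable_def borel_measurable_restrict_space_iff)
  moreover have "(\<lambda>s. (f s)\<^sup>2) absolutely_integrable_on {a..b} \<longleftrightarrow> (\<lambda>s. (f s)\<^sup>2) integrable_on {a..b}"
    by (intro absolutely_integrable_on_iff_nonneg) auto
  ultimately show ?thesis unfolding square_integrable_on_def by simp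
qed

lemma integral_nonneg_total:
  fixes f :: "real \<Rightarrow> real"
  shows "(\<And>s. s \<in> S \<Longrightarrow> 0 \<le> f s) \<Longrightarrow> 0 \<le> integral S f"
  by (cases "f integrable_on S") (auto intro: integral_nonneg simp: not_integrable_integral)

lemma integral_split_at:
  fixes f :: "real \<Rightarrow> real"
  assumes "f integrable_on {a..c}" "a \<le> t" "t \<le> c"
  shows "integral {a..c} f = integral {a..t} f + integral {t..c} f"
  using Henstock_Kurzweil_Integration.integral_combine[OF assms(2,3,1)] by simp

lemma square_integrable_integrable_power2:
  "square_integrable_on {a..b} f \<Longrightarrow> (\<lambda>s. (f s)\<^sup>2) integrable_on {a..b}"
  by (simp add: square_integrable_on_iff)

lemma square_integrable_mult:
  assumes "square_integrable_on {a..b} f" "square_integrable_on {a..b} g"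
  shows "(\<lambda>s. f s * g s) absolutely_integrable_on {a..b}"
proof (rule measurable_bounded_by_integrable_imp_absolutely_integrable)
  show "(\<lambda>s. f s * g s) \<in> borel_measurable (lebesgue_on {a..b})"
    using assms by (auto simp: square_integrable_on_iff intro!: borel_measurable_times)
  show "(\<lambda>s. (f s)\<^sup>2 + (g s)\<^sup>2) integrable_on {a..b}"
    using assms by (intro integrable_add) (simp_all add: square_integrable_on_iff)
  fix s
  have "2 * (\<bar>f s\<bar> * \<bar>g s\<bar>) \<le> (f s)\<^sup>2 + (g s)\<^sup>2"
    using sum_squares_bound[of "\<bar>f s\<bar>" "\<bar>g s\<bar>"] by simp
  then show "norm (f s * g s) \<le> (f s)\<^sup>2 + (g s)\<^sup>2" by (simp add: abs_mult)
       (smt (verit) mult_nonneg_nonneg abs_ge_zero)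
qed auto

lemma square_integrable_continuous:
  fixes f :: "real \<Rightarrow> real"
  assumes "continuous_on {a..b} f"
  shows "square_integrable_on {a..b} f"
  unfolding square_integrable_on_iff
  using assms by (auto intro!: integrable_continuous_real continuous_intros continuous_imp_measurable_on_sets_lebesgue)

lemma square_integrable_absolutely_integrable:
  assumes "square_integrable_on {a..b} f"
  shows "f absolutely_integrable_on {a..b}"
  using square_integrable_mult[OF assms square_integrable_continuous[of a b "\<lambda>_. 1"]] by simp

lemma square_integrable_integrable:
  "square_integrable_on {a..b} f \<Longrightarrow> f integrable_on {a..b}"
  using square_integrable_absolutely_integrable absolutely_integrable_on_def by blast

lemma square_integrable_abs_integrable:
  "square_integrable_on {a..b} f \<Longrightarrow> (\<lambda>s. \<bar>f s\<bar>) integrable_on {a..b}"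
  using square_integrable_absolutely_integrable[of a b f] by (simp add: absolutely_integrable_on_def)

lemma square_integrable_mult_integrable:
  "square_integrable_on {a..b} f \<Longrightarrow> square_integrable_on {a..b} g \<Longrightarrow> (\<lambda>s. f s * g s) integrable_on {a..b}"
  using square_integrable_mult absolutely_integrable_on_def by blast

lemma square_integrable_cmult:
  "square_integrable_on {a..b} f \<Longrightarrow> square_integrable_on {a..b} (\<lambda>s. c * f s)"
  by (auto simp: square_integrable_on_iff power_mult_distrib intro!: integrable_on_mult_right)

lemma square_integrable_add:
  assumes "square_integrable_on {a..b} f" "square_integrable_on {a..b} g"
  shows "square_integrable_on {a..b} (\<lambda>s. f s + g s)"
proof -
  have "(\<lambda>s. (f s)\<^sup>2 + (g s)\<^sup>2 + 2 * (f s * g s)) integrable_on {a..b}"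
    using assms square_integrable_mult_integrable[OF assms]
    by (intro integrable_add integrable_on_mult_right) (auto simp: square_integrable_on_iff)
  then show ?thesis using assms
    by (auto simp: square_integrable_on_iff power2_sum mult.assoc)
qed

lemma square_integrable_diff:
  assumes "square_integrable_on {a..b} f" "square_integrable_on {a..b} g"
  shows "square_integrable_on {a..b} (\<lambda>s. f s - g s)"
  using square_integrable_add[OF assms(1) square_integrable_cmult[OF assms(2), of "-1"]] by simp

lemma square_integrable_subinterval:
  assumes "square_integrable_on {a..b} f" "{c..d} \<subseteq> {a..b}"
  shows "square_integrable_on {c..d} f"
  unfolding square_integrable_on_iff
proof
  show "f \<in> borel_measurable (lebesgue_on {c..d})"
    using assms(1) measurable_restrict_mono[OF _ assms(2)] unfolding square_integrable_on_iff by blast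
  show "(\<lambda>s. (f s)\<^sup>2) integrable_on {c..d}"
    by (rule integrable_subinterval_real[OF square_integrable_integrable_power2[OF assms(1)] assms(2)])
qed

lemma square_integrable_join:
  assumes "square_integrable_on {a..c} f" "square_integrable_on {c..b} g" "a \<le> c" "c \<le> b"
  shows "square_integrable_on {a..b} (\<lambda>s. if s < c then f s else g s)" (is "square_integrable_on _ ?h")
proof -
  have neg: "negligible {c}" by simp
  have "(\<lambda>s. (?h s)\<^sup>2) integrable_on {a..c}"
    by (rule integrable_spike[OF square_integrable_integrable_power2[OF assms(1)] neg]) auto
  moreover have "(\<lambda>s. (?h s)\<^sup>2) integrable_on {c..b}"
    by (rule integrable_eq[OF square_integrable_integrable_power2[OF assms(2)]]) auto
  ultimately have "(\<lambda>s. (?h s)\<^sup>2) integrable_on {a..b}"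
    using Henstock_Kurzweil_Integration.integrable_combine assms(3,4) by blast
  moreover have "?h \<in> borel_measurable (lebesgue_on {a..b})"
  proof -
    have 1: "?h integrable_on {a..c}"
      by (rule integrable_spike[OF square_integrable_integrable[OF assms(1)] neg]) auto
    have 2: "?h integrable_on {c..b}"
      by (rule integrable_eq[OF square_integrable_integrable[OF assms(2)]]) auto
    have "?h integrable_on {a..b}"
      using 1 2 Henstock_Kurzweil_Integration.integrable_combine assms(3,4) by blast
    then show ?thesis by (rule integrable_imp_measurable)
  qed
  ultimately show ?thesis by (simp add: square_integrable_on_iff)
qed

text \<open>The Cauchy-Schwarz inequality against a constant, read off from the nonnegative integral of
  \<open>(\<bar>f\<bar> - m)\<^sup>2\<close>, where \<open>m\<close> is the mean of \<open>\<bar>f\<bar>\<close>.\<close>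

lemma integral_abs_le_sqrt:
  assumes f: "square_integrable_on {a..b} f" and ab: "a < b"
  shows "integral {a..b} (\<lambda>s. \<bar>f s\<bar>) \<le> sqrt ((b - a) * integral {a..b} (\<lambda>s. (f s)\<^sup>2))"
proof -
  define I where "I = integral {a..b} (\<lambda>s. \<bar>f s\<bar>)"
  define m where "m = I / (b - a)"
  have i2: "(\<lambda>s. (f s)\<^sup>2) integrable_on {a..b}" and i1: "(\<lambda>s. \<bar>f s\<bar>) integrable_on {a..b}"
    using f square_integrable_integrable_power2 square_integrable_abs_integrable by auto
  have "0 \<le> integral {a..b} (\<lambda>s. (f s)\<^sup>2 - 2 * m * \<bar>f s\<bar> + m\<^sup>2)"
  proof (rule integral_nonneg)
    show "(\<lambda>s. (f s)\<^sup>2 - 2 * m * \<bar>f s\<bar> + m\<^sup>2) integrable_on {a..b}"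
      by (intro integrable_add integrable_diff integrable_on_mult_right i1 i2) auto
    fix s show "0 \<le> (f s)\<^sup>2 - 2 * m * \<bar>f s\<bar> + m\<^sup>2"
      using zero_le_power2[of "\<bar>f s\<bar> - m"] by (simp add: power2_diff algebra_simps)
  qed
  also have "\<dots> = integral {a..b} (\<lambda>s. (f s)\<^sup>2) - 2 * m * I + m\<^sup>2 * (b - a)"
  proof -
    have "((\<lambda>s. (f s)\<^sup>2 - 2 * m * \<bar>f s\<bar> + m\<^sup>2) has_integral
        integral {a..b} (\<lambda>s. (f s)\<^sup>2) - 2 * m * I + (b - a) *\<^sub>R m\<^sup>2) {a..b}"
      unfolding I_def using ab has_integral_const_real[of "m\<^sup>2" a b]
      by (intro has_integral_add has_integral_diff has_integral_mult_right integrable_integral i1 i2) simp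
    then show ?thesis by (simp add: integral_unique mult.commute)
  qed
  also have "\<dots> = integral {a..b} (\<lambda>s. (f s)\<^sup>2) - I\<^sup>2 / (b - a)"
  proof -
    have "m * (b - a) = I" using ab by (simp add: m_def)
    then have "m\<^sup>2 * (b - a) = m * I" "I\<^sup>2 / (b - a) = m * I"
      by (auto simp: m_def power2_eq_square)
    then show ?thesis by simp
  qed
  finally have "I\<^sup>2 \<le> (b - a) * integral {a..b} (\<lambda>s. (f s)\<^sup>2)"
    using ab by (simp add: field_simps)
  then show ?thesis unfolding I_def[symmetric] by (rule real_le_rsqrt)
qed

text \<open>The Riesz-Fischer theorem. On a bounded interval an \<open>L\<^sup>2\<close> Cauchy sequence is also Cauchy in \<open>L\<^sup>1\<close>,
  so a subsequence converges almost everywhere; Fatou's lemma bounds the distance of its limit to the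
  members of the sequence.\<close>

theorem square_integrable_complete:
  fixes u :: "nat \<Rightarrow> real \<Rightarrow> real"
  assumes sq: "\<And>n. square_integrable_on {a..b} (u n)" and ab: "a < b"
    and cau: "\<And>e. e > 0 \<Longrightarrow> \<exists>N. \<forall>m\<ge>N. \<forall>n\<ge>N. integral {a..b} (\<lambda>s. (u m s - u n s)\<^sup>2) < e"
  obtains v where "square_integrable_on {a..b} v"
    and "(\<lambda>n. integral {a..b} (\<lambda>s. (v s - u n s)\<^sup>2)) \<longlonglongrightarrow> 0"
proof -
  let ?S = "{a..b}"
  let ?M = "lebesgue_on ?S"
  have int: "integrable ?M g \<longleftrightarrow> g absolutely_integrable_on ?S" for g :: "real \<Rightarrow> real"
    by (simp add: set_integrable_def integrable_restrict_space)
  have eq: "integral\<^sup>L ?M g = integral ?S g" if "g absolutely_integrable_on ?S" for g :: "real \<Rightarrow> real"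
    using lebesgue_integral_eq_integral[of ?S g] that by (simp add: int)
  have sqd: "square_integrable_on ?S (\<lambda>s. u m s - u n s)" for m n
    by (intro square_integrable_diff sq)
  have meas [measurable]: "u n \<in> borel_measurable ?M" for n
    using sq[of n] by (simp add: square_integrable_on_iff)
  have L1: "\<exists>N. \<forall>i\<ge>N. \<forall>j\<ge>N. (LINT x|?M. norm (u i x - u j x)) < e" if "e > 0" for e
  proof -
    have "e\<^sup>2 / (b - a) > 0" using that ab by simp
    from cau[OF this]
    obtain N where N: "\<forall>m\<ge>N. \<forall>n\<ge>N. integral ?S (\<lambda>s. (u m s - u n s)\<^sup>2) < e\<^sup>2 / (b - a)" ..
    have "(LINT x|?M. norm (u i x - u j x)) < e" if "i \<ge> N" "j \<ge> N" for i j
    proof -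
      have "(LINT x|?M. norm (u i x - u j x)) = integral ?S (\<lambda>s. \<bar>u i s - u j s\<bar>)"
        unfolding real_norm_def using square_integrable_abs_integrable[OF sqd[of i j]]
        by (intro eq nonnegative_absolutely_integrable_1) simp_all
      also have "\<dots> \<le> sqrt ((b - a) * integral ?S (\<lambda>s. (u i s - u j s)\<^sup>2))"
        by (rule integral_abs_le_sqrt[OF sqd ab])
      also have "\<dots> < sqrt (e\<^sup>2)"
      proof (rule real_sqrt_less_mono)
        have "integral ?S (\<lambda>s. (u i s - u j s)\<^sup>2) < e\<^sup>2 / (b - a)" using N that by blast
        then show "(b - a) * integral ?S (\<lambda>s. (u i s - u j s)\<^sup>2) < e\<^sup>2"
          using ab by (simp add: pos_less_divide_eq mult.commute)
      qed
      finally show ?thesis using \<open>e > 0\<close> by simp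
    qed
    then show ?thesis by blast
  qed
  have intu: "integrable ?M (u n)" for n
    unfolding int by (rule square_integrable_absolutely_integrable[OF sq])
  obtain r where r: "strict_mono r" and AEc: "AE x in ?M. Cauchy (\<lambda>i. u (r i) x)"
    by (rule cauchy_L1_AE_cauchy_subseq[OF intu L1])
  define v where "v = (\<lambda>x. lim (\<lambda>i. u (r i) x))"
  have [measurable]: "v \<in> borel_measurable ?M"
    unfolding v_def by (rule borel_measurable_lim_metric) simp
  have lim: "AE x in ?M. (\<lambda>i. u (r i) x) \<longlonglongrightarrow> v x"
    using AEc by eventually_elim (auto simp: v_def dest: Cauchy_convergent[THEN convergent_LIMSEQ_iff[THEN iffD1]])
  have fatou: "integrable ?M (\<lambda>x. (v x - u n x)\<^sup>2) \<and> integral ?S (\<lambda>x. (v x - u n x)\<^sup>2) \<le> e"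
    if N: "\<forall>m\<ge>N. \<forall>n\<ge>N. integral ?S (\<lambda>s. (u m s - u n s)\<^sup>2) < e" "n \<ge> N" and e: "e > 0" for N n e
  proof -
    have "(\<integral>\<^sup>+x. ennreal ((v x - u n x)\<^sup>2) \<partial>?M) = (\<integral>\<^sup>+x. liminf (\<lambda>i. ennreal ((u (r i) x - u n x)\<^sup>2)) \<partial>?M)"
    proof (rule nn_integral_cong_AE)
      show "AE x in ?M. ennreal ((v x - u n x)\<^sup>2) = liminf (\<lambda>i. ennreal ((u (r i) x - u n x)\<^sup>2))"
        using lim
      proof eventually_elim
        case (elim x)
        have "(\<lambda>i. ennreal ((u (r i) x - u n x)\<^sup>2)) \<longlonglongrightarrow> ennreal ((v x - u n x)\<^sup>2)"
          by (intro tendsto_ennrealI tendsto_intros elim)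
        then show ?case by (rule lim_imp_Liminf[OF sequentially_bot, symmetric])
      qed
    qed
    also have "\<dots> \<le> liminf (\<lambda>i. \<integral>\<^sup>+x. ennreal ((u (r i) x - u n x)\<^sup>2) \<partial>?M)"
      by (rule nn_integral_liminf) simp
    also have "\<dots> \<le> ennreal e"
    proof (rule Liminf_le)
      show "\<forall>\<^sub>F i in sequentially. (\<integral>\<^sup>+x. ennreal ((u (r i) x - u n x)\<^sup>2) \<partial>?M) \<le> ennreal e"
        using eventually_ge_at_top[of N]
      proof eventually_elim
        case (elim i)
        have ai: "(\<lambda>x. (u (r i) x - u n x)\<^sup>2) absolutely_integrable_on ?S"
          using square_integrable_integrable_power2[OF sqd] by (intro nonnegative_absolutely_integrable_1) auto
        have "r i \<ge> N" using elim seq_suble[OF r, of i] by linarith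
        then have "integral ?S (\<lambda>x. (u (r i) x - u n x)\<^sup>2) < e" using N by blast
        then have "ennreal (integral\<^sup>L ?M (\<lambda>x. (u (r i) x - u n x)\<^sup>2)) \<le> ennreal e"
          unfolding eq[OF ai] by (intro ennreal_leI) simp
        then show ?case
          using nn_integral_eq_integral[OF int[THEN iffD2, OF ai]] by simp
      qed
    qed auto
    finally have le: "(\<integral>\<^sup>+x. ennreal ((v x - u n x)\<^sup>2) \<partial>?M) \<le> ennreal e" .
    have i: "integrable ?M (\<lambda>x. (v x - u n x)\<^sup>2)"
    proof (rule integrableI_bounded)
      show "(\<integral>\<^sup>+x. ennreal (norm ((v x - u n x)\<^sup>2)) \<partial>?M) < \<infinity>"
        using le_less_trans[OF le ennreal_less_top] by simp
    qed simp
    have "ennreal (integral\<^sup>L ?M (\<lambda>x. (v x - u n x)\<^sup>2)) \<le> ennreal e"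
      using nn_integral_eq_integral[OF i] le by simp
    then have "integral\<^sup>L ?M (\<lambda>x. (v x - u n x)\<^sup>2) \<le> e" using e by (simp add: ennreal_le_iff)
    then show ?thesis using i by (simp add: int eq)
  qed
  show thesis
  proof
    obtain N where N: "\<forall>m\<ge>N. \<forall>n\<ge>N. integral ?S (\<lambda>s. (u m s - u n s)\<^sup>2) < 1" using cau[OF zero_less_one] ..
    have "integrable ?M (\<lambda>x. (v x - u N x)\<^sup>2)"
      by (rule conjunct1[OF fatou[OF N order_refl zero_less_one]])
    then have "(\<lambda>x. (v x - u N x)\<^sup>2) integrable_on ?S"
      unfolding int absolutely_integrable_on_def by (rule conjunct1)
    then have "square_integrable_on ?S (\<lambda>x. v x - u N x)"
      by (simp add: square_integrable_on_iff)
    from square_integrable_add[OF this sq[of N]] show "square_integrable_on ?S v" by simp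
    show "(\<lambda>n. integral ?S (\<lambda>s. (v s - u n s)\<^sup>2)) \<longlonglongrightarrow> 0"
    proof (rule LIMSEQ_I)
      fix e :: real assume e: "e > 0"
      obtain N where N: "\<forall>m\<ge>N. \<forall>n\<ge>N. integral ?S (\<lambda>s. (u m s - u n s)\<^sup>2) < e/2" using cau[OF half_gt_zero[OF e]] ..
      have "norm (integral ?S (\<lambda>s. (v s - u n s)\<^sup>2) - 0) < e" if "n \<ge> N" for n
      proof -
        have "integral ?S (\<lambda>s. (v s - u n s)\<^sup>2) \<ge> 0"
          by (rule integral_nonneg_total) simp
        then show ?thesis using fatou[OF N that half_gt_zero[OF e]] e by simp
      qed
      then show "\<exists>no. \<forall>n\<ge>no. norm (integral ?S (\<lambda>s. (v s - u n s)\<^sup>2) - 0) < e" by blast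
    qed
  qed
qed

section \<open>Trajectories of a Lipschitz drift with a control\<close>

text \<open>The hypothesis says that \<open>exp (- L (s - a)) (K + L \<integral>d)\<close> has a nonpositive derivative.\<close>

lemma gronwall:
  fixes d :: "real \<Rightarrow> real"
  assumes cont: "continuous_on {a..c} d" and L: "L \<ge> 0"
    and le: "\<And>s. s \<in> {a..c} \<Longrightarrow> d s \<le> K + L * integral {a..s} d"
    and s: "s \<in> {a..c}"
  shows "d s \<le> K * exp (L * (s - a))"
proof -
  define D where "D = (\<lambda>s. integral {a..s} d)"
  define G where "G = (\<lambda>s. exp (- L * (s - a)) * (K + L * D s))"
  have cD: "continuous_on {a..c} D"
    unfolding D_def by (intro indefinite_integral_continuous_1 integrable_continuous_real cont)
  have "G s \<le> G a"
  proof (rule DERIV_nonpos_imp_decreasing_open[of a s G])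
    show "a \<le> s" using s by simp
    show "continuous_on {a..s} G"
      unfolding G_def using continuous_on_subset[OF cD, of "{a..s}"] s by (intro continuous_intros) auto
    fix r assume r: "a < r" "r < s"
    then have r': "r \<in> {a..c}" "r \<in> interior {a..c}" using s by auto
    have "(D has_real_derivative d r) (at r within {a..c})"
      unfolding D_def by (rule integral_has_real_derivative[OF cont r'(1)])
    then have "(D has_real_derivative d r) (at r)" using at_within_interior[OF r'(2)] by simp
    then have "(G has_real_derivative exp (- L * (r - a)) * L * (d r - (K + L * D r))) (at r)"
      unfolding G_def by (auto intro!: derivative_eq_intros simp: algebra_simps)
    moreover have "exp (- L * (r - a)) * L * (d r - (K + L * D r)) \<le> 0"
      using L le[OF r'(1)] unfolding D_def by (intro mult_nonneg_nonpos) auto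
    ultimately show "\<exists>y. (G has_real_derivative y) (at r) \<and> y \<le> 0" by blast
  qed
  then have "exp (- L * (s - a)) * (K + L * D s) \<le> K" by (simp add: G_def D_def)
  moreover have e: "exp (L * (s - a)) * exp (- L * (s - a)) = 1"
    by (simp add: exp_add[symmetric])
  ultimately have "exp (L * (s - a)) * (exp (- L * (s - a)) * (K + L * D s)) \<le> exp (L * (s - a)) * K"
    by (intro mult_left_mono) auto
  then have "K + L * D s \<le> K * exp (L * (s - a))"
    by (simp only: mult.assoc[symmetric] e mult_1) (simp add: mult.commute)
  then show ?thesis using le[OF s] unfolding D_def by linarith
qed

locale lipschitz_drift =
  fixes T A :: real and b :: "real \<Rightarrow> real \<Rightarrow> real"
  assumes A_nonneg: "A \<ge> 0"
    and continuous_drift: "continuous_on (UNIV \<times> {..T}) (\<lambda>(y, s). b y s)"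
    and lipschitz_drift: "\<And>y z s. s \<le> T \<Longrightarrow> \<bar>b y s - b z s\<bar> \<le> A * \<bar>y - z\<bar>"
begin

lemma continuous_on_drift [continuous_intros]:
  assumes "continuous_on S g" "continuous_on S h" "\<And>s. s \<in> S \<Longrightarrow> h s \<le> T"
  shows "continuous_on S (\<lambda>s. b (g s) (h s))"
  using continuous_on_compose2[OF continuous_drift, of S "\<lambda>s. (g s, h s)"] assms
  by (auto intro!: continuous_intros)

text \<open>Picard's fixed point argument with Bielecki's norm: for the supremum norm with weight
  \<open>exp (- L (s - t))\<close> and \<open>L \<ge> 2 A\<close> the integral operator contracts by the factor \<open>1/2\<close> on the whole
  interval. In the proof \<open>f\<close> is the solution times the weight; it is extended to the line by the
  retraction \<open>\<sigma>\<close> onto the interval, so that the complete space of bounded continuous functions can be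
  used.\<close>

lemma integral_equation_solution:
  assumes tT: "t < T" and g: "continuous_on {t..T} g"
  shows "\<exists>z. continuous_on {t..T} z \<and> (\<forall>s\<in>{t..T}. z s = g s + integral {t..s} (\<lambda>r. b (z r) r))"
proof -
  define \<sigma> where "\<sigma> = (\<lambda>s. max t (min T s))"
  define L where "L = 2 * A + 1"
  define W where "W = (\<lambda>(f::real\<Rightarrow>real) s. exp (- L * (s - t)) * (g s + integral {t..s} (\<lambda>r. b (exp (L * (r - t)) * f r) r)))"
  define \<Phi> where "\<Phi> = (\<lambda>f::real \<Rightarrow>\<^sub>C real. Bcontfun (\<lambda>s. W (apply_bcontfun f) (\<sigma> s)))"
  have L: "L > 0" "A \<le> L / 2" using A_nonneg by (auto simp: L_def)
  have \<sigma>: "continuous_on UNIV \<sigma>" "\<sigma> s \<in> {t..T}" "s \<in> {t..T} \<Longrightarrow> \<sigma> s = s" for s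
    using tT unfolding \<sigma>_def by (auto intro!: continuous_intros)
  have intg: "continuous_on {t..T} (\<lambda>r. b (exp (L * (r - t)) * apply_bcontfun f r) r)" for f
    by (intro continuous_intros continuous_on_subset[OF continuous_on_apply_bcontfun]) auto
  have cW: "continuous_on {t..T} (W (apply_bcontfun f))" for f
    unfolding W_def
    by (intro continuous_intros g indefinite_integral_continuous_1 integrable_continuous_real intg)
  have bc: "(\<lambda>s. W (apply_bcontfun f) (\<sigma> s)) \<in> bcontfun" for f
  proof -
    have "continuous_on UNIV (\<lambda>s. W (apply_bcontfun f) (\<sigma> s))"
      by (rule continuous_on_compose2[OF cW \<sigma>(1)]) (use \<sigma>(2) in auto)
    moreover have "range (\<lambda>s. W (apply_bcontfun f) (\<sigma> s)) \<subseteq> W (apply_bcontfun f) ` {t..T}" using \<sigma>(2) by auto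
    then have "bounded (range (\<lambda>s. W (apply_bcontfun f) (\<sigma> s)))"
      using compact_imp_bounded[OF compact_continuous_image[OF cW compact_Icc]] bounded_subset by blast
    ultimately show ?thesis by (simp add: bcontfun_def)
  qed
  have \<Phi>: "apply_bcontfun (\<Phi> f) s = W (apply_bcontfun f) (\<sigma> s)" for f s
    unfolding \<Phi>_def using Bcontfun_inverse[OF bc] by simp
  have "dist (\<Phi> f) (\<Phi> h) \<le> (1/2) * dist f h" for f h
  proof (rule dist_bound)
    fix s
    let ?s = "\<sigma> s" let ?D = "dist f h"
    have sT: "?s \<in> {t..T}" by (rule \<sigma>)
    have sub: "{t..?s} \<subseteq> {t..T}" using sT by auto
    have ex: "integral {t..?s} (\<lambda>r. A * exp (L * (r - t)) * ?D) \<le> 1/2 * exp (L * (?s - t)) * ?D"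
    proof -
      have "((\<lambda>r. exp (L * (r - t))) has_integral (exp (L * (?s - t)) / L - exp (L * (t - t)) / L)) {t..?s}"
        using sT L by (intro fundamental_theorem_of_calculus)
          (auto intro!: derivative_eq_intros simp: has_real_derivative_iff_has_vector_derivative[symmetric])
      then have "((\<lambda>r. A * exp (L * (r - t)) * ?D) has_integral A * (exp (L * (?s - t)) / L - 1 / L) * ?D) {t..?s}"
        by (intro has_integral_mult_left has_integral_mult_right) simp
      then have "integral {t..?s} (\<lambda>r. A * exp (L * (r - t)) * ?D) = A * (exp (L * (?s - t)) / L - 1 / L) * ?D"
        by (rule integral_unique)
      also have "\<dots> \<le> (L/2) * (exp (L * (?s - t)) / L) * ?D"
        using L sT A_nonneg by (intro mult_right_mono mult_mono) (auto simp: field_simps)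
      finally show ?thesis using L by simp
    qed
    have "\<bar>integral {t..?s} (\<lambda>r. b (exp (L * (r - t)) * f r) r) - integral {t..?s} (\<lambda>r. b (exp (L * (r - t)) * h r) r)\<bar>
      = \<bar>integral {t..?s} (\<lambda>r. b (exp (L * (r - t)) * f r) r - b (exp (L * (r - t)) * h r) r)\<bar>"
      using intg continuous_on_subset[OF intg sub] by (subst integral_diff) (auto intro!: integrable_continuous_real)
    also have "\<dots> \<le> integral {t..?s} (\<lambda>r. A * exp (L * (r - t)) * ?D)"
      unfolding real_norm_def[symmetric]
    proof (rule integral_norm_bound_integral)
      show "(\<lambda>r. b (exp (L * (r - t)) * f r) r - b (exp (L * (r - t)) * h r) r) integrable_on {t..?s}"
        by (intro integrable_continuous_real continuous_intros continuous_on_subset[OF intg sub])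
      show "(\<lambda>r. A * exp (L * (r - t)) * ?D) integrable_on {t..?s}"
        by (intro integrable_continuous_real continuous_intros)
      fix r assume r: "r \<in> {t..?s}"
      have "\<bar>b (exp (L * (r - t)) * f r) r - b (exp (L * (r - t)) * h r) r\<bar> \<le> A * \<bar>exp (L * (r - t)) * f r - exp (L * (r - t)) * h r\<bar>"
        by (rule lipschitz_drift) (use r sT in auto)
      also have "\<dots> = A * exp (L * (r - t)) * dist (f r) (h r)"
        by (simp add: dist_real_def abs_mult right_diff_distrib[symmetric])
      also have "\<dots> \<le> A * exp (L * (r - t)) * ?D"
        using A_nonneg by (intro mult_left_mono dist_bounded) auto
      finally show "norm (b (exp (L * (r - t)) * f r) r - b (exp (L * (r - t)) * h r) r) \<le> A * exp (L * (r - t)) * ?D" by simp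
    qed
    finally have le: "\<bar>integral {t..?s} (\<lambda>r. b (exp (L * (r - t)) * f r) r) - integral {t..?s} (\<lambda>r. b (exp (L * (r - t)) * h r) r)\<bar>
       \<le> 1/2 * exp (L * (?s - t)) * ?D" using ex by linarith
    have "dist (\<Phi> f s) (\<Phi> h s) = exp (- L * (?s - t)) * \<bar>integral {t..?s} (\<lambda>r. b (exp (L * (r - t)) * f r) r) - integral {t..?s} (\<lambda>r. b (exp (L * (r - t)) * h r) r)\<bar>"
      unfolding \<Phi> W_def dist_real_def by (simp add: abs_mult right_diff_distrib[symmetric])
    also have "\<dots> \<le> exp (- L * (?s - t)) * (1/2 * exp (L * (?s - t)) * ?D)"
      by (intro mult_left_mono le) auto
    also have "\<dots> = 1/2 * ?D" by (simp add: exp_minus)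
    finally show "dist (\<Phi> f s) (\<Phi> h s) \<le> (1/2) * ?D" .
  qed
  then obtain f where f: "\<Phi> f = f" using banach_fix_type[of "1/2" \<Phi>] by auto
  define z where "z = (\<lambda>s. exp (L * (s - t)) * apply_bcontfun f s)"
  have "continuous_on {t..T} z"
    unfolding z_def by (intro continuous_intros continuous_on_subset[OF continuous_on_apply_bcontfun]) auto
  moreover have "z s = g s + integral {t..s} (\<lambda>r. b (z r) r)" if s: "s \<in> {t..T}" for s
  proof -
    have "z s = exp (L * (s - t)) * W (apply_bcontfun f) s"
      using \<Phi>[of f s] \<sigma>(3)[OF s] by (simp add: f z_def)
    also have "\<dots> = g s + integral {t..s} (\<lambda>r. b (z r) r)"
      unfolding W_def z_def by (simp add: mult.assoc[symmetric] exp_add[symmetric])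
    finally show ?thesis .
  qed
  ultimately show ?thesis by blast
qed

text \<open>The integrated form of \<open>z' = b(z, s) + u(s)\<close>, \<open>z(t) = y\<close>, for a control \<open>u\<close> that is only square
  integrable.\<close>

definition trajectory :: "real \<Rightarrow> real \<Rightarrow> (real \<Rightarrow> real) \<Rightarrow> (real \<Rightarrow> real) \<Rightarrow> bool" where
  "trajectory t y u z \<longleftrightarrow> square_integrable_on {t..T} u \<and> continuous_on {t..T} z \<and>
     (\<forall>s\<in>{t..T}. z s = y + integral {t..s} (\<lambda>r. b (z r) r + u r))"

lemma trajectoryD:
  assumes "trajectory t y u z"
  shows "square_integrable_on {t..T} u" "continuous_on {t..T} z"
    and "s \<in> {t..T} \<Longrightarrow> z s = y + integral {t..s} (\<lambda>r. b (z r) r + u r)"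
    and "continuous_on {t..T} (\<lambda>r. b (z r) r)"
    and "square_integrable_on {t..T} (\<lambda>r. b (z r) r + u r)"
    and "t \<le> T \<Longrightarrow> z t = y"
proof -
  show 1: "square_integrable_on {t..T} u" and 2: "continuous_on {t..T} z"
    and "s \<in> {t..T} \<Longrightarrow> z s = y + integral {t..s} (\<lambda>r. b (z r) r + u r)"
    using assms by (auto simp: trajectory_def)
  show 3: "continuous_on {t..T} (\<lambda>r. b (z r) r)" by (intro continuous_intros 2) auto
  show "square_integrable_on {t..T} (\<lambda>r. b (z r) r + u r)"
    by (intro square_integrable_add square_integrable_continuous 3 1)
  show "z t = y" if "t \<le> T" using assms that by (auto simp: trajectory_def)
qed

lemma trajectory_increment:
  assumes z: "trajectory t y u z" and "t \<le> r" "r \<le> s" "s \<le> T"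
  shows "z s = z r + integral {r..s} (\<lambda>r. b (z r) r + u r)"
proof -
  have "(\<lambda>r. b (z r) r + u r) integrable_on {t..s}"
    by (rule integrable_subinterval_real[OF square_integrable_integrable[OF trajectoryD(5)[OF z]]]) (use assms in auto)
  from Henstock_Kurzweil_Integration.integral_combine[OF assms(2,3) this]
  show ?thesis using trajectoryD(3)[OF z, of s] trajectoryD(3)[OF z, of r] assms by simp
qed

lemma trajectory_exists:
  assumes tT: "t < T" and u: "square_integrable_on {t..T} u"
  shows "\<exists>z. trajectory t y u z"
proof -
  have iu: "u integrable_on {t..T}" using u by (rule square_integrable_integrable)
  have "continuous_on {t..T} (\<lambda>s. y + integral {t..s} u)"
    by (intro continuous_intros indefinite_integral_continuous_1 iu)
  from integral_equation_solution[OF tT this] obtain z where z: "continuous_on {t..T} z"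
    "\<forall>s\<in>{t..T}. z s = y + integral {t..s} u + integral {t..s} (\<lambda>r. b (z r) r)" by blast
  have "z s = y + integral {t..s} (\<lambda>r. b (z r) r + u r)" if s: "s \<in> {t..T}" for s
  proof -
    have "(\<lambda>r. b (z r) r) integrable_on {t..s}" "u integrable_on {t..s}"
      using s by (auto intro!: integrable_continuous_real continuous_intros continuous_on_subset[OF z(1)] integrable_subinterval_real[OF iu])
    then show ?thesis using z(2) s by (simp add: integral_add)
  qed
  then show ?thesis using z(1) u unfolding trajectory_def by blast
qed

text \<open>If \<open>w\<close> were above \<open>z\<close> at \<open>s\<close>, the two would meet at a last time \<open>s0 < s\<close>. From then on \<open>w - z\<close> is
  nonnegative and at most \<open>A\<close> times its own integral, so it vanishes by Gronwall's inequality.\<close>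

lemma trajectory_comparison:
  assumes w: "trajectory t y0 v w" and z: "trajectory t y1 u z"
    and y: "y0 \<le> y1" and vu: "\<And>s. s \<in> {t..T} \<Longrightarrow> v s \<le> u s" and s: "s \<in> {t..T}"
  shows "w s \<le> z s"
proof (rule ccontr)
  define d where "d = (\<lambda>s. w s - z s)"
  assume "\<not> w s \<le> z s"
  then have ds: "d s > 0" by (simp add: d_def)
  have cd: "continuous_on {t..T} d" unfolding d_def by (intro continuous_intros trajectoryD[OF w] trajectoryD[OF z])
  have cds: "continuous_on {r..s} d" if "t \<le> r" for r using s that by (intro continuous_on_subset[OF cd]) auto
  have dt: "d t \<le> 0" using y trajectoryD(6)[OF w] trajectoryD(6)[OF z] s by (simp add: d_def)
  define Z where "Z = {r \<in> {t..s}. d r = 0}"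
  have zero: "\<exists>c\<ge>r. c \<le> s \<and> d c = 0" if "t \<le> r" "r \<le> s" "d r \<le> 0" for r
    using IVT'[of d r 0 s] that ds cds by auto
  have "Z \<noteq> {}" using zero[of t] dt s by (auto simp: Z_def)
  moreover have "compact Z"
    unfolding Z_def using continuous_closed_preimage_constant[OF cds[of t] closed_atLeastAtMost, of 0]
    by (simp add: compact_eq_bounded_closed bounded_subset[OF bounded_closed_interval, of _ t s] Collect_mono_iff)
       (auto intro: bounded_subset[OF bounded_closed_interval, of _ t s])
  ultimately obtain s0 where s0: "s0 \<in> Z" "\<And>r. r \<in> Z \<Longrightarrow> r \<le> s0" using compact_attains_sup by metis
  have s0': "t \<le> s0" "s0 \<le> s" "d s0 = 0" using s0(1) by (auto simp: Z_def)
  have pos: "d r \<ge> 0" if r: "s0 \<le> r" "r \<le> s" for r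
  proof (rule ccontr)
    assume "\<not> d r \<ge> 0"
    then obtain c where "c \<ge> r" "c \<le> s" "d c = 0" using zero[of r] r s0' by auto
    then have "c \<in> Z" "c \<ge> r" using s0' r by (auto simp: Z_def)
    then have "r = s0" using s0(2)[of c] r by linarith
    then show False using \<open>\<not> d r \<ge> 0\<close> s0' by simp
  qed
  have "d s \<le> 0 * exp (A * (s - s0))"
  proof (rule gronwall[OF cds[OF s0'(1)] A_nonneg])
    show "s \<in> {s0..s}" using s0' by simp
    fix r assume r: "r \<in> {s0..s}"
    have iw: "(\<lambda>r. b (w r) r + v r) integrable_on {s0..r}"
      by (rule integrable_subinterval_real[OF square_integrable_integrable[OF trajectoryD(5)[OF w]]]) (use r s s0' in auto)
    have iz: "(\<lambda>r. b (z r) r + u r) integrable_on {s0..r}"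
      by (rule integrable_subinterval_real[OF square_integrable_integrable[OF trajectoryD(5)[OF z]]]) (use r s s0' in auto)
    have "d r = integral {s0..r} (\<lambda>r. b (w r) r + v r) - integral {s0..r} (\<lambda>r. b (z r) r + u r)"
      using trajectory_increment[OF w, of s0 r] trajectory_increment[OF z, of s0 r] s0' r s
      by (simp add: d_def)
    also have "\<dots> = integral {s0..r} (\<lambda>r. (b (w r) r + v r) - (b (z r) r + u r))"
      by (rule integral_diff[OF iw iz, symmetric])
    also have "\<dots> \<le> integral {s0..r} (\<lambda>r. A * d r)"
    proof (rule integral_le)
      show "(\<lambda>r. (b (w r) r + v r) - (b (z r) r + u r)) integrable_on {s0..r}"
        by (intro integrable_diff iw iz)
      show "(\<lambda>r. A * d r) integrable_on {s0..r}"
        using r by (intro integrable_continuous_real continuous_intros continuous_on_subset[OF cds[OF s0'(1)]]) auto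
      fix x assume x: "x \<in> {s0..r}"
      have "b (w x) x - b (z x) x \<le> A * \<bar>w x - z x\<bar>" using lipschitz_drift[of x "w x" "z x"] x r s by auto
      moreover have "w x - z x \<ge> 0" using pos[of x] x r by (simp add: d_def)
      moreover have "v x \<le> u x" using vu[of x] x r s s0' by auto
      ultimately show "b (w x) x + v x - (b (z x) x + u x) \<le> A * d x" by (simp add: d_def)
    qed
    finally show "d r \<le> 0 + A * integral {s0..r} d" by simp
  qed
  then show False using ds by simp
qed

text \<open>Gronwall's inequality for \<open>\<bar>w - z\<bar>\<close>. Only the controls up to time \<open>s\<close> enter, which makes the estimate
  useful over short times.\<close>

lemma trajectory_stability_upto:
  assumes w: "trajectory t y0 v w" and z: "trajectory t y1 u z" and s: "s \<in> {t..T}"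
  shows "\<bar>w s - z s\<bar> \<le> (\<bar>y0 - y1\<bar> + integral {t..s} (\<lambda>r. \<bar>v r - u r\<bar>)) * exp (A * (T - t))"
proof -
  define K where "K = \<bar>y0 - y1\<bar> + integral {t..s} (\<lambda>r. \<bar>v r - u r\<bar>)"
  have sub: "{t..s} \<subseteq> {t..T}" using s by auto
  have "(\<lambda>r. \<bar>v r - u r\<bar>) integrable_on {t..T}"
    by (intro square_integrable_abs_integrable square_integrable_diff trajectoryD(1)[OF w] trajectoryD(1)[OF z])
  then have ivu: "(\<lambda>r. \<bar>v r - u r\<bar>) integrable_on {t..s}"
    by (rule integrable_subinterval_real[OF _ sub])
  have cd: "continuous_on {t..s} (\<lambda>s. \<bar>w s - z s\<bar>)"
    by (intro continuous_intros continuous_on_subset[OF _ sub] trajectoryD[OF w] trajectoryD[OF z])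
  have "\<bar>w s - z s\<bar> \<le> K * exp (A * (s - t))"
  proof (rule gronwall[OF cd A_nonneg])
    show "s \<in> {t..s}" using s by simp
    fix r assume rs: "r \<in> {t..s}"
    then have r: "r \<in> {t..T}" using s by simp
    have iw: "(\<lambda>r. b (w r) r + v r) integrable_on {t..r}"
      by (rule integrable_subinterval_real[OF square_integrable_integrable[OF trajectoryD(5)[OF w]]]) (use r in auto)
    have iz: "(\<lambda>r. b (z r) r + u r) integrable_on {t..r}"
      by (rule integrable_subinterval_real[OF square_integrable_integrable[OF trajectoryD(5)[OF z]]]) (use r in auto)
    have icd: "(\<lambda>s. A * \<bar>w s - z s\<bar>) integrable_on {t..r}"
      using r by (intro integrable_continuous_real continuous_intros continuous_on_subset[OF trajectoryD(2)[OF w]]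
         continuous_on_subset[OF trajectoryD(2)[OF z]]) auto
    have ivu': "(\<lambda>r. \<bar>v r - u r\<bar>) integrable_on {t..r}"
      by (rule integrable_subinterval_real[OF ivu]) (use rs in auto)
    have "w r - z r = y0 - y1 + integral {t..r} (\<lambda>r. (b (w r) r + v r) - (b (z r) r + u r))"
      using trajectoryD(3)[OF w r] trajectoryD(3)[OF z r] integral_diff[OF iw iz] by simp
    moreover have "\<bar>integral {t..r} (\<lambda>r. (b (w r) r + v r) - (b (z r) r + u r))\<bar>
        \<le> integral {t..r} (\<lambda>s. A * \<bar>w s - z s\<bar> + \<bar>v s - u s\<bar>)"
      unfolding real_norm_def[symmetric]
    proof (rule integral_norm_bound_integral)
      show "(\<lambda>r. (b (w r) r + v r) - (b (z r) r + u r)) integrable_on {t..r}"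
        by (intro integrable_diff iw iz)
      show "(\<lambda>s. A * norm (w s - z s) + norm (v s - u s)) integrable_on {t..r}"
        using integrable_add[OF icd ivu'] by simp
      fix x assume x: "x \<in> {t..r}"
      have "\<bar>b (w x) x - b (z x) x\<bar> \<le> A * \<bar>w x - z x\<bar>" using lipschitz_drift[of x "w x" "z x"] x r by auto
      then show "norm (b (w x) x + v x - (b (z x) x + u x)) \<le> A * norm (w x - z x) + norm (v x - u x)"
        by (simp add: abs_if split: if_splits)
    qed
    moreover have "integral {t..r} (\<lambda>s. A * \<bar>w s - z s\<bar> + \<bar>v s - u s\<bar>) =
       A * integral {t..r} (\<lambda>s. \<bar>w s - z s\<bar>) + integral {t..r} (\<lambda>s. \<bar>v s - u s\<bar>)"
      using integral_add[OF icd ivu'] by simp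
    moreover have "integral {t..r} (\<lambda>s. \<bar>v s - u s\<bar>) \<le> integral {t..s} (\<lambda>s. \<bar>v s - u s\<bar>)"
      using rs by (intro integral_subset_le ivu ivu') auto
    ultimately show "\<bar>w r - z r\<bar> \<le> K + A * integral {t..r} (\<lambda>s. \<bar>w s - z s\<bar>)"
      unfolding K_def by linarith
  qed
  also have "\<dots> \<le> K * exp (A * (T - t))"
  proof (rule mult_left_mono)
    show "exp (A * (s - t)) \<le> exp (A * (T - t))" using s A_nonneg by (simp add: mult_left_mono)
    show "0 \<le> K" unfolding K_def by (intro add_nonneg_nonneg integral_nonneg_total) auto
  qed
  finally show ?thesis unfolding K_def .
qed


corollary trajectory_stability:
  assumes w: "trajectory t y0 v w" and z: "trajectory t y1 u z" and s: "s \<in> {t..T}"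
  shows "\<bar>w s - z s\<bar> \<le> (\<bar>y0 - y1\<bar> + integral {t..T} (\<lambda>r. \<bar>v r - u r\<bar>)) * exp (A * (T - t))"
proof -
  have i: "(\<lambda>r. \<bar>v r - u r\<bar>) integrable_on {t..T}"
    by (intro square_integrable_abs_integrable square_integrable_diff trajectoryD(1)[OF w] trajectoryD(1)[OF z])
  have "integral {t..s} (\<lambda>r. \<bar>v r - u r\<bar>) \<le> integral {t..T} (\<lambda>r. \<bar>v r - u r\<bar>)"
    using s by (intro integral_subset_le integrable_subinterval_real[OF i] i) auto
  then have "(\<bar>y0 - y1\<bar> + integral {t..s} (\<lambda>r. \<bar>v r - u r\<bar>)) * exp (A * (T - t)) \<le>
      (\<bar>y0 - y1\<bar> + integral {t..T} (\<lambda>r. \<bar>v r - u r\<bar>)) * exp (A * (T - t))"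
    by (intro mult_right_mono) auto
  then show ?thesis using trajectory_stability_upto[OF w z s] by linarith
qed

end

section \<open>Convexity, optimal controls and minimizers\<close>

context lipschitz_drift begin

text \<open>Every absolutely continuous path is a trajectory: its control is the part of the velocity that the
  drift does not provide.\<close>

lemma trajectory_of_density:
  assumes f: "square_integrable_on {t..T} f"
    and w: "\<And>s. s \<in> {t..T} \<Longrightarrow> w s = y + integral {t..s} f"
  shows "trajectory t y (\<lambda>s. f s - b (w s) s) w"
proof -
  have "continuous_on {t..T} (\<lambda>s. y + integral {t..s} f)"
    by (intro continuous_intros indefinite_integral_continuous_1 square_integrable_integrable f)
  then have c: "continuous_on {t..T} w" by (rule continuous_on_eq) (use w in simp)
  have "continuous_on {t..T} (\<lambda>s. b (w s) s)" by (intro continuous_intros c) auto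
  from square_integrable_diff[OF f square_integrable_continuous[OF this]]
  show ?thesis
    unfolding trajectory_def using c w by simp
qed

lemma trajectory_affine_combination:
  fixes \<alpha> \<beta> :: real
  assumes z0: "trajectory t y0 u0 z0" and z1: "trajectory t y1 u1 z1"
  defines "w \<equiv> \<lambda>s. \<alpha> * z0 s + \<beta> * z1 s"
  shows "trajectory t (\<alpha> * y0 + \<beta> * y1)
           (\<lambda>s. \<alpha> * (b (z0 s) s + u0 s) + \<beta> * (b (z1 s) s + u1 s) - b (w s) s) w"
proof (rule trajectory_of_density)
  show "square_integrable_on {t..T} (\<lambda>s. \<alpha> * (b (z0 s) s + u0 s) + \<beta> * (b (z1 s) s + u1 s))"
    by (intro square_integrable_add square_integrable_cmult trajectoryD(5)[OF z0] trajectoryD(5)[OF z1])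
  fix s assume s: "s \<in> {t..T}"
  have i: "(\<lambda>s. b (z0 s) s + u0 s) integrable_on {t..s}" "(\<lambda>s. b (z1 s) s + u1 s) integrable_on {t..s}"
    using square_integrable_integrable[OF trajectoryD(5)[OF z0]] square_integrable_integrable[OF trajectoryD(5)[OF z1]] s
    by (auto intro: integrable_subinterval_real)
  have "((\<lambda>s. \<alpha> * (b (z0 s) s + u0 s) + \<beta> * (b (z1 s) s + u1 s)) has_integral
     \<alpha> * integral {t..s} (\<lambda>s. b (z0 s) s + u0 s) + \<beta> * integral {t..s} (\<lambda>s. b (z1 s) s + u1 s)) {t..s}"
    by (intro has_integral_add has_integral_mult_right integrable_integral i)
  from integral_unique[OF this]
  show "w s = \<alpha> * y0 + \<beta> * y1 + integral {t..s} (\<lambda>s. \<alpha> * (b (z0 s) s + u0 s) + \<beta> * (b (z1 s) s + u1 s))"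
    unfolding w_def trajectoryD(3)[OF z0 s] trajectoryD(3)[OF z1 s] by (simp only: distrib_left add_ac)
qed

text \<open>The key use of concavity. The convex combination of \<open>z0\<close> and \<open>z1\<close> is a trajectory whose control is the
  combined control minus the nonnegative concavity gap of \<open>b\<close>; comparison puts it below the
  trajectory of the combined control.\<close>

lemma trajectory_mix:
  assumes conc: "\<And>s. s \<in> {t..T} \<Longrightarrow> concave_on UNIV (\<lambda>y. b y s)" and tT: "t < T"
    and z0: "trajectory t y0 u0 z0" and z1: "trajectory t y1 u1 z1" and \<theta>: "0 \<le> \<theta>" "\<theta> \<le> 1"
  shows "\<exists>z. trajectory t ((1 - \<theta>) * y0 + \<theta> * y1) (\<lambda>s. (1 - \<theta>) * u0 s + \<theta> * u1 s) z
           \<and> (1 - \<theta>) * z0 T + \<theta> * z1 T \<le> z T"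
proof -
  let ?u = "\<lambda>s. (1 - \<theta>) * u0 s + \<theta> * u1 s"
  let ?w = "\<lambda>s. (1 - \<theta>) * z0 s + \<theta> * z1 s"
  let ?y = "(1 - \<theta>) * y0 + \<theta> * y1"
  have "square_integrable_on {t..T} ?u"
    by (intro square_integrable_add square_integrable_cmult trajectoryD(1)[OF z0] trajectoryD(1)[OF z1])
  then obtain z where z: "trajectory t ?y ?u z" using trajectory_exists[OF tT] by blast
  have "?w T \<le> z T"
  proof (rule trajectory_comparison[OF trajectory_affine_combination[OF z0 z1] z order_refl])
    fix s assume "s \<in> {t..T}"
    from concave_onD[OF conc[OF this], of \<theta> "z0 s" "z1 s"] \<theta>
    have "(1 - \<theta>) * b (z0 s) s + \<theta> * b (z1 s) s \<le> b (?w s) s" by simp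
    then show "(1 - \<theta>) * (b (z0 s) s + u0 s) + \<theta> * (b (z1 s) s + u1 s) - b (?w s) s \<le> ?u s"
      by (simp add: distrib_left)
  qed (use tT in simp)
  then show ?thesis using z by blast
qed

end

definition energy :: "real \<Rightarrow> real \<Rightarrow> (real \<Rightarrow> real) \<Rightarrow> real" where
  "energy t T u = 1/2 * integral {t..T} (\<lambda>s. (u s)\<^sup>2)"

lemma energy_nonneg: "0 \<le> energy t T u"
  unfolding energy_def by (simp add: integral_nonneg_total)

text \<open>For \<open>\<theta> = 1/2\<close> this is the parallelogram identity.\<close>

lemma energy_mix:
  assumes u: "square_integrable_on {t..T} u" and v: "square_integrable_on {t..T} v"
  shows "energy t T (\<lambda>s. (1 - \<theta>) * u s + \<theta> * v s) =
    (1 - \<theta>) * energy t T u + \<theta> * energy t T v - \<theta> * (1 - \<theta>) * energy t T (\<lambda>s. u s - v s)"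
proof -
  have i: "(\<lambda>s. (u s)\<^sup>2) integrable_on {t..T}" "(\<lambda>s. (v s)\<^sup>2) integrable_on {t..T}"
    "(\<lambda>s. (u s - v s)\<^sup>2) integrable_on {t..T}"
    using u v square_integrable_diff[OF u v] by (auto intro: square_integrable_integrable_power2)
  have "((\<lambda>s. (1 - \<theta>) * (u s)\<^sup>2 + \<theta> * (v s)\<^sup>2 - \<theta> * (1 - \<theta>) * (u s - v s)\<^sup>2) has_integral
     (1 - \<theta>) * integral {t..T} (\<lambda>s. (u s)\<^sup>2) + \<theta> * integral {t..T} (\<lambda>s. (v s)\<^sup>2)
      - \<theta> * (1 - \<theta>) * integral {t..T} (\<lambda>s. (u s - v s)\<^sup>2)) {t..T}"
    by (intro has_integral_add has_integral_diff has_integral_mult_right integrable_integral i)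
  moreover have "(1 - \<theta>) * (u s)\<^sup>2 + \<theta> * (v s)\<^sup>2 - \<theta> * (1 - \<theta>) * (u s - v s)\<^sup>2 =
     ((1 - \<theta>) * u s + \<theta> * v s)\<^sup>2" for s
    by (simp add: power2_eq_square algebra_simps)
  ultimately have "integral {t..T} (\<lambda>s. ((1 - \<theta>) * u s + \<theta> * v s)\<^sup>2) =
     (1 - \<theta>) * integral {t..T} (\<lambda>s. (u s)\<^sup>2) + \<theta> * integral {t..T} (\<lambda>s. (v s)\<^sup>2)
      - \<theta> * (1 - \<theta>) * integral {t..T} (\<lambda>s. (u s - v s)\<^sup>2)"
    by (simp only: integral_unique)
  then show ?thesis unfolding energy_def by (simp add: right_diff_distrib distrib_left mult.left_commute)
qed

context lipschitz_drift begin

lemma trajectory_equal_of_energy_diff_zero: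
  assumes z0: "trajectory t y u0 z0" and z1: "trajectory t y u1 z1" and tT: "t < T"
    and e: "energy t T (\<lambda>s. u0 s - u1 s) \<le> 0" and s: "s \<in> {t..T}"
  shows "z0 s = z1 s"
proof -
  have "integral {t..T} (\<lambda>s. \<bar>u0 s - u1 s\<bar>) \<le> sqrt ((T - t) * integral {t..T} (\<lambda>s. (u0 s - u1 s)\<^sup>2))"
    by (intro integral_abs_le_sqrt square_integrable_diff trajectoryD(1)[OF z0] trajectoryD(1)[OF z1] tT)
  also have "integral {t..T} (\<lambda>s. (u0 s - u1 s)\<^sup>2) = 0"
    using e energy_nonneg[of t T "\<lambda>s. u0 s - u1 s"] unfolding energy_def by simp
  finally have "integral {t..T} (\<lambda>s. \<bar>u0 s - u1 s\<bar>) = 0"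
    using integral_nonneg_total[of "{t..T}" "\<lambda>s. \<bar>u0 s - u1 s\<bar>"] by simp
  then show ?thesis using trajectory_stability[OF z0 z1 s] by simp
qed

definition steers :: "real \<Rightarrow> real \<Rightarrow> real \<Rightarrow> (real \<Rightarrow> real) \<Rightarrow> bool" where
  "steers x y t u \<longleftrightarrow> (\<exists>z. trajectory t y u z \<and> x \<le> z T)"

lemma steers_square_integrable: "steers x y t u \<Longrightarrow> square_integrable_on {t..T} u"
  unfolding steers_def trajectory_def by blast

lemma steers_mix:
  assumes conc: "\<And>s. s \<in> {t..T} \<Longrightarrow> concave_on UNIV (\<lambda>y. b y s)" and tT: "t < T"
    and "steers x0 y0 t u0" and "steers x1 y1 t u1" and \<theta>: "0 \<le> \<theta>" "\<theta> \<le> 1"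
  shows "steers ((1 - \<theta>) * x0 + \<theta> * x1) ((1 - \<theta>) * y0 + \<theta> * y1) t (\<lambda>s. (1 - \<theta>) * u0 s + \<theta> * u1 s)"
proof -
  obtain z0 z1 where z: "trajectory t y0 u0 z0" "x0 \<le> z0 T" "trajectory t y1 u1 z1" "x1 \<le> z1 T"
    using assms unfolding steers_def by blast
  obtain z where "trajectory t ((1 - \<theta>) * y0 + \<theta> * y1) (\<lambda>s. (1 - \<theta>) * u0 s + \<theta> * u1 s) z"
    "(1 - \<theta>) * z0 T + \<theta> * z1 T \<le> z T"
    using trajectory_mix[OF conc tT z(1,3) \<theta>] by blast
  moreover have "(1 - \<theta>) * x0 + \<theta> * x1 \<le> (1 - \<theta>) * z0 T + \<theta> * z1 T"
    using z \<theta> by (intro add_mono mult_left_mono) auto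
  ultimately show ?thesis unfolding steers_def by fastforce
qed

lemma steers_exists:
  assumes tT: "t < T"
  shows "\<exists>u. steers x y t u"
proof -
  define \<beta> where "\<beta> = (x - y) / (T - t)"
  have "trajectory t y (\<lambda>s. \<beta> - b (y + \<beta> * (s - t)) s) (\<lambda>s. y + \<beta> * (s - t))"
    by (rule trajectory_of_density) (auto intro!: square_integrable_continuous)
  moreover have "y + \<beta> * (T - t) = x" using tT by (simp add: \<beta>_def)
  ultimately show ?thesis unfolding steers_def by (metis order_refl)
qed

text \<open>The argument of the projection theorem: the midpoint of two controls steers as well, so the
  parallelogram identity makes a minimizing sequence Cauchy. The set of steering controls is closed since
  the endpoint of a trajectory depends continuously on the control.\<close>

theorem optimal_control_exists:
  assumes conc: "\<And>s. s \<in> {t..T} \<Longrightarrow> concave_on UNIV (\<lambda>y. b y s)" and tT: "t < T"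
  shows "\<exists>u. steers x y t u \<and> (\<forall>v. steers x y t v \<longrightarrow> energy t T u \<le> energy t T v)"
proof -
  let ?E = "energy t T"
  define m where "m = Inf (?E ` Collect (steers x y t))"
  have bdd: "bdd_below (?E ` Collect (steers x y t))" using energy_nonneg by (intro bdd_belowI) auto
  have ne: "?E ` Collect (steers x y t) \<noteq> {}" using steers_exists[OF tT] by auto
  have m_le: "m \<le> ?E u" if "steers x y t u" for u
    unfolding m_def by (rule cInf_lower[OF _ bdd]) (use that in auto)
  have "\<exists>u. steers x y t u \<and> ?E u < m + 1 / real (Suc n)" for n
    using cInf_lessD[OF ne, of "m + 1 / real (Suc n)"] unfolding m_def by auto
  then obtain U where U: "\<And>n. steers x y t (U n)" "\<And>n. ?E (U n) < m + 1 / real (Suc n)" by metis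
  note sqU = steers_square_integrable[OF U(1)]
  have near: "integral {t..T} (\<lambda>s. (U i s - U j s)\<^sup>2) \<le> 4 / real (Suc i) + 4 / real (Suc j)" for i j
  proof -
    have "steers x y t (\<lambda>s. (1 - 1/2) * U i s + 1/2 * U j s)"
      using steers_mix[OF conc tT U(1)[of i] U(1)[of j], of "1/2"] by (simp add: field_simps)
    then have "m \<le> ?E (\<lambda>s. (1 - 1/2) * U i s + 1/2 * U j s)" by (rule m_le)
    also have "\<dots> = 1/2 * ?E (U i) + 1/2 * ?E (U j) - 1/4 * ?E (\<lambda>s. U i s - U j s)"
      by (subst energy_mix[OF sqU sqU]) simp
    finally show ?thesis using U(2)[of i] U(2)[of j] unfolding energy_def by linarith
  qed
  have "\<exists>N. \<forall>i\<ge>N. \<forall>j\<ge>N. integral {t..T} (\<lambda>s. (U i s - U j s)\<^sup>2) < e" if "e > 0" for e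
  proof -
    obtain N where N: "1 / real (Suc N) < e / 8" using nat_approx_posE[of "e/8"] \<open>e > 0\<close> by auto
    have "integral {t..T} (\<lambda>s. (U i s - U j s)\<^sup>2) < e" if "i \<ge> N" "j \<ge> N" for i j
    proof -
      have "1 / real (Suc i) \<le> 1 / real (Suc N)" "1 / real (Suc j) \<le> 1 / real (Suc N)"
        using that by (auto intro!: divide_left_mono)
      then show ?thesis using near[of i j] N by simp
    qed
    then show ?thesis by blast
  qed
  from square_integrable_complete[OF sqU tT this] obtain v where v: "square_integrable_on {t..T} v"
    and lim: "(\<lambda>n. integral {t..T} (\<lambda>s. (v s - U n s)\<^sup>2)) \<longlonglongrightarrow> 0" by blast
  have "steers x y t v"
  proof -
    obtain z where z: "trajectory t y v z" using trajectory_exists[OF tT v] by blast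
    have "\<exists>w. trajectory t y (U n) w \<and> x \<le> w T" for n using U(1) unfolding steers_def by blast
    then obtain w where w: "\<And>n. trajectory t y (U n) (w n)" "\<And>n. x \<le> w n T" by metis
    have "x - z T \<le> sqrt ((T - t) * integral {t..T} (\<lambda>s. (v s - U n s)\<^sup>2)) * exp (A * (T - t))" for n
    proof -
      have "w n T - z T \<le> (\<bar>y - y\<bar> + integral {t..T} (\<lambda>s. \<bar>v s - U n s\<bar>)) * exp (A * (T - t))"
        using trajectory_stability[OF z w(1)[of n], of T] tT by simp
      also have "\<dots> \<le> sqrt ((T - t) * integral {t..T} (\<lambda>s. (v s - U n s)\<^sup>2)) * exp (A * (T - t))"
        using integral_abs_le_sqrt[OF square_integrable_diff[OF v sqU[of n]] tT] by simp
      finally show ?thesis using w(2)[of n] by linarith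
    qed
    moreover have "(\<lambda>n. sqrt ((T - t) * integral {t..T} (\<lambda>s. (v s - U n s)\<^sup>2)) * exp (A * (T - t)))
        \<longlonglongrightarrow> sqrt ((T - t) * 0) * exp (A * (T - t))"
      by (intro tendsto_intros lim)
    ultimately have "x - z T \<le> sqrt ((T - t) * 0) * exp (A * (T - t))"
      by (intro LIMSEQ_le_const) blast+
    then show ?thesis unfolding steers_def using z by auto
  qed
  moreover have "?E v \<le> m"
  proof -
    \<comment> \<open>Continuity of the energy, in the form \<open>v\<^sup>2 \<le> (1 + \<epsilon>) u\<^sup>2 + (1 + 1/\<epsilon>) (v - u)\<^sup>2\<close>.\<close>
    have bound: "integral {t..T} (\<lambda>s. (v s)\<^sup>2) \<le> (1 + \<epsilon>) * (2 * m)" if \<epsilon>: "\<epsilon> > 0" for \<epsilon>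
    proof (rule LIMSEQ_le_const)
      show "(\<lambda>n. (1 + \<epsilon>) * (2 * (m + inverse (real (Suc n)))) + (1 + 1/\<epsilon>) * integral {t..T} (\<lambda>s. (v s - U n s)\<^sup>2))
          \<longlonglongrightarrow> (1 + \<epsilon>) * (2 * m)"
        by (rule tendsto_eq_intros lim LIMSEQ_inverse_real_of_nat refl)+ simp
      show "\<exists>N. \<forall>n\<ge>N. integral {t..T} (\<lambda>s. (v s)\<^sup>2)
          \<le> (1 + \<epsilon>) * (2 * (m + inverse (real (Suc n)))) + (1 + 1/\<epsilon>) * integral {t..T} (\<lambda>s. (v s - U n s)\<^sup>2)"
      proof (intro exI allI impI)
        fix n
        have i: "(\<lambda>s. (U n s)\<^sup>2) integrable_on {t..T}" "(\<lambda>s. (v s - U n s)\<^sup>2) integrable_on {t..T}" "(\<lambda>s. (v s)\<^sup>2) integrable_on {t..T}"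
          using v sqU[of n] square_integrable_diff[OF v sqU[of n]] by (auto intro: square_integrable_integrable_power2)
        have "integral {t..T} (\<lambda>s. (v s)\<^sup>2) \<le> integral {t..T} (\<lambda>s. (1 + \<epsilon>) * (U n s)\<^sup>2 + (1 + 1/\<epsilon>) * (v s - U n s)\<^sup>2)"
        proof (rule integral_le)
          show "(\<lambda>s. (1 + \<epsilon>) * (U n s)\<^sup>2 + (1 + 1/\<epsilon>) * (v s - U n s)\<^sup>2) integrable_on {t..T}"
            by (intro integrable_add integrable_on_mult_right i)
          fix s
          have "0 \<le> (\<epsilon> * U n s - (v s - U n s))\<^sup>2 / \<epsilon>" using \<epsilon> by simp
          also have "\<dots> = \<epsilon> * (U n s)\<^sup>2 - 2 * (U n s) * (v s - U n s) + 1/\<epsilon> * (v s - U n s)\<^sup>2"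
            using \<epsilon> by (simp add: power2_eq_square field_simps)
          finally show "(v s)\<^sup>2 \<le> (1 + \<epsilon>) * (U n s)\<^sup>2 + (1 + 1/\<epsilon>) * (v s - U n s)\<^sup>2"
            by (simp add: power2_eq_square algebra_simps)
        qed (rule i)
        also have "\<dots> = (1 + \<epsilon>) * integral {t..T} (\<lambda>s. (U n s)\<^sup>2) + (1 + 1/\<epsilon>) * integral {t..T} (\<lambda>s. (v s - U n s)\<^sup>2)"
          by (intro integral_unique has_integral_add has_integral_mult_right integrable_integral i)
        also have "(1 + \<epsilon>) * integral {t..T} (\<lambda>s. (U n s)\<^sup>2) \<le> (1 + \<epsilon>) * (2 * (m + inverse (real (Suc n))))"
          using U(2)[of n] \<epsilon> unfolding energy_def by (intro mult_left_mono) (auto simp: inverse_eq_divide)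
        finally show "integral {t..T} (\<lambda>s. (v s)\<^sup>2)
          \<le> (1 + \<epsilon>) * (2 * (m + inverse (real (Suc n)))) + (1 + 1/\<epsilon>) * integral {t..T} (\<lambda>s. (v s - U n s)\<^sup>2)" by simp
      qed
    qed
    have "integral {t..T} (\<lambda>s. (v s)\<^sup>2) \<le> (1 + 0) * (2 * m)"
    proof (rule LIMSEQ_le_const)
      show "(\<lambda>n. (1 + inverse (real (Suc n))) * (2 * m)) \<longlonglongrightarrow> (1 + 0) * (2 * m)"
        by (intro tendsto_intros LIMSEQ_inverse_real_of_nat)
      show "\<exists>N. \<forall>n\<ge>N. integral {t..T} (\<lambda>s. (v s)\<^sup>2) \<le> (1 + inverse (real (Suc n))) * (2 * m)"
        using bound by simp
    qed
    then show ?thesis unfolding energy_def by simp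
  qed
  ultimately show ?thesis using m_le order_trans by blast
qed

lemma optimal_trajectory_unique:
  assumes conc: "\<And>s. s \<in> {t..T} \<Longrightarrow> concave_on UNIV (\<lambda>y. b y s)" and tT: "t < T"
    and z0: "trajectory t y u0 z0" "x \<le> z0 T" and z1: "trajectory t y u1 z1" "x \<le> z1 T"
    and opt: "\<And>v. steers x y t v \<Longrightarrow> energy t T u0 \<le> energy t T v"
      "\<And>v. steers x y t v \<Longrightarrow> energy t T u1 \<le> energy t T v"
    and s: "s \<in> {t..T}"
  shows "z0 s = z1 s"
proof (rule trajectory_equal_of_energy_diff_zero[OF z0(1) z1(1) tT _ s])
  have st: "steers x y t u0" "steers x y t u1" using z0 z1 unfolding steers_def by blast+
  have "steers x y t (\<lambda>s. (1 - 1/2) * u0 s + 1/2 * u1 s)"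
    using steers_mix[OF conc tT st, of "1/2"] by (simp add: field_simps)
  from opt(1)[OF this] have "energy t T u0 \<le> 1/2 * energy t T u0 + 1/2 * energy t T u1 - 1/4 * energy t T (\<lambda>s. u0 s - u1 s)"
    by (subst (asm) energy_mix[OF trajectoryD(1)[OF z0(1)] trajectoryD(1)[OF z1(1)]]) simp
  moreover have "energy t T u0 = energy t T u1" using opt st by (meson order_antisym)
  ultimately show "energy t T (\<lambda>s. u0 s - u1 s) \<le> 0" by simp
qed

lemma admissible_paths_iff:
  "\<gamma> \<in> admissible_paths T x y t \<longleftrightarrow> (\<exists>u z. trajectory t y u z \<and> x \<le> z T \<and> \<gamma> = restrict z {t..T})"
  if tT: "t < T"
proof -
  have LI: "(LINT r:{t..s}|lebesgue. f r) = integral {t..s} f" if "square_integrable_on {t..T} f" "s \<in> {t..T}" for f s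
  proof (rule set_lebesgue_integral_eq_integral(2))
    show "set_integrable lebesgue {t..s} f"
      by (rule square_integrable_absolutely_integrable[OF square_integrable_subinterval[OF that(1)]]) (use that in auto)
  qed
  show ?thesis
  proof
    assume "\<gamma> \<in> admissible_paths T x y t"
    then obtain f where f: "square_integrable_on {t..T} f" "\<gamma> = (\<lambda>s\<in>{t..T}. y + (LINT r:{t..s}|lebesgue. f r))" "x \<le> \<gamma> T"
      unfolding admissible_paths_def by blast
    define z where "z = (\<lambda>s. y + integral {t..s} f)"
    have g: "\<gamma> = restrict z {t..T}" unfolding f(2) z_def using LI[OF f(1)] by (auto simp: restrict_def)
    moreover have "trajectory t y (\<lambda>s. f s - b (z s) s) z"
      by (rule trajectory_of_density[OF f(1)]) (simp add: z_def)
    moreover have "x \<le> z T" using f(3) g tT by simp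
    ultimately show "\<exists>u z. trajectory t y u z \<and> x \<le> z T \<and> \<gamma> = restrict z {t..T}" by blast
  next
    assume "\<exists>u z. trajectory t y u z \<and> x \<le> z T \<and> \<gamma> = restrict z {t..T}"
    then obtain u z where z: "trajectory t y u z" "x \<le> z T" "\<gamma> = restrict z {t..T}" by blast
    have "\<gamma> = (\<lambda>s\<in>{t..T}. y + (LINT r:{t..s}|lebesgue. b (z r) r + u r))"
      unfolding z(3) using trajectoryD(3)[OF z(1)] LI[OF trajectoryD(5)[OF z(1)]] by (auto simp: restrict_def)
    moreover have "\<gamma> T \<ge> x" using z tT by simp
    ultimately show "\<gamma> \<in> admissible_paths T x y t"
      unfolding admissible_paths_def using trajectoryD(5)[OF z(1)] by blast
  qed
qed

text \<open>Almost everywhere the derivative of the path is \<open>b(z, s) + u\<close>. Both endpoints belong to the exceptional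
  null set, since the restricted path has no useful derivative there.\<close>

lemma action_trajectory:
  assumes z: "trajectory t y u z"
  shows "action b T t (restrict z {t..T}) = energy t T u"
proof -
  define F where "F = (\<lambda>r. b (z r) r + u r)"
  define N where "N = {s \<in> {t<..<T}. \<not> ((\<lambda>s. integral {t..s} F) has_real_derivative F s) (at s)}"
  have "negligible N" unfolding N_def F_def
    by (intro indefinite_integral_has_derivative_ae square_integrable_integrable trajectoryD(5)[OF z])
  then have neg: "negligible (N \<union> {t, T})" by simp
  let ?\<gamma> = "restrict z {t..T}"
  have eq: "(deriv ?\<gamma> s - b (?\<gamma> s) s)\<^sup>2 = (u s)\<^sup>2" if s: "s \<in> {t..T} - (N \<union> {t, T})" for s
  proof -
    have s': "s \<in> {t<..<T}" "((\<lambda>s. integral {t..s} F) has_real_derivative F s) (at s)"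
      using s unfolding N_def by auto
    have "((\<lambda>s. y + integral {t..s} F) has_real_derivative F s) (at s)"
      using DERIV_add[OF DERIV_const s'(2)] by simp
    then have "(?\<gamma> has_real_derivative F s) (at s)"
      by (rule has_field_derivative_transform_within_open[OF _ open_greaterThanLessThan s'(1)])
         (use trajectoryD(3)[OF z] in \<open>auto simp: F_def\<close>)
    then have "deriv ?\<gamma> s = F s" by (rule DERIV_imp_deriv)
    then show ?thesis using s by (simp add: F_def)
  qed
  have ai: "(\<lambda>s. (u s)\<^sup>2) absolutely_integrable_on {t..T}"
    using trajectoryD(1)[OF z] by (simp add: square_integrable_on_def)
  have "(\<lambda>s. (deriv ?\<gamma> s - b (?\<gamma> s) s)\<^sup>2) absolutely_integrable_on {t..T}"
    by (rule absolutely_integrable_spike[OF ai neg eq])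
  then have "(LINT s:{t..T}|lebesgue. (deriv ?\<gamma> s - b (?\<gamma> s) s)\<^sup>2) = integral {t..T} (\<lambda>s. (deriv ?\<gamma> s - b (?\<gamma> s) s)\<^sup>2)"
    by (rule set_lebesgue_integral_eq_integral(2))
  also have "\<dots> = integral {t..T} (\<lambda>s. (u s)\<^sup>2)"
    by (rule integral_spike[OF neg]) (use eq in auto)
  finally show ?thesis unfolding action_def energy_def by simp
qed

theorem minimizer_unique:
  assumes conc: "\<And>s. s \<in> {t..T} \<Longrightarrow> concave_on UNIV (\<lambda>y. b y s)" and tT: "t < T"
  shows "\<exists>!\<gamma>. is_minimizer b T x y t \<gamma>"
proof -
  have iff: "is_minimizer b T x y t (restrict z {t..T}) \<longleftrightarrow> (\<forall>v. steers x y t v \<longrightarrow> energy t T u \<le> energy t T v)"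
    if z: "trajectory t y u z" "x \<le> z T" for u z
  proof -
    have "(\<forall>\<eta>. \<eta> \<in> admissible_paths T x y t \<longrightarrow> energy t T u \<le> action b T t \<eta>) \<longleftrightarrow>
        (\<forall>v. steers x y t v \<longrightarrow> energy t T u \<le> energy t T v)"
      unfolding admissible_paths_iff[OF tT] steers_def using action_trajectory by metis
    moreover have "restrict z {t..T} \<in> admissible_paths T x y t"
      using admissible_paths_iff[OF tT] z by blast
    ultimately show ?thesis
      unfolding is_minimizer_def is_arg_min_linorder action_trajectory[OF z(1)] by blast
  qed
  obtain u where u: "steers x y t u" "\<forall>v. steers x y t v \<longrightarrow> energy t T u \<le> energy t T v"
    using optimal_control_exists[OF conc tT] by blast
  then obtain z where z: "trajectory t y u z" "x \<le> z T" unfolding steers_def by blast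
  show ?thesis
  proof (rule ex1I)
    show "is_minimizer b T x y t (restrict z {t..T})" using iff[OF z] u by blast
    fix \<gamma> assume \<gamma>: "is_minimizer b T x y t \<gamma>"
    then have "\<gamma> \<in> admissible_paths T x y t" unfolding is_minimizer_def is_arg_min_def by blast
    then obtain v w where w: "trajectory t y v w" "x \<le> w T" "\<gamma> = restrict w {t..T}"
      using admissible_paths_iff[OF tT] by blast
    have "w s = z s" if "s \<in> {t..T}" for s
      by (rule optimal_trajectory_unique[OF conc tT w(1,2) z _ _ that]) (use \<gamma> iff[OF w(1,2)] u w(3) in auto)
    then show "\<gamma> = restrict z {t..T}" using w(3) by (auto simp: restrict_def)
  qed
qed

lemma q_le_energy:
  assumes tT: "t < T" and u: "steers x y t u"
  shows "q b T x y t \<le> energy t T u"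
proof -
  obtain z where z: "trajectory t y u z" "x \<le> z T" using u unfolding steers_def by blast
  then have adm: "restrict z {t..T} \<in> admissible_paths T x y t" using admissible_paths_iff[OF tT] tT by auto
  have "bdd_below (action b T t ` admissible_paths T x y t)"
    using admissible_paths_iff[OF tT] action_trajectory energy_nonneg by (intro bdd_belowI[of _ 0]) fastforce
  from cINF_lower[OF this adm] show ?thesis unfolding q_def action_trajectory[OF z(1)] .
qed

lemma q_attained:
  assumes conc: "\<And>s. s \<in> {t..T} \<Longrightarrow> concave_on UNIV (\<lambda>y. b y s)" and tT: "t < T"
  obtains u where "steers x y t u" "q b T x y t = energy t T u"
proof -
  obtain u where u: "steers x y t u" "\<forall>v. steers x y t v \<longrightarrow> energy t T u \<le> energy t T v"
    using optimal_control_exists[OF conc tT] by blast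
  have "energy t T u \<le> q b T x y t"
    unfolding q_def
  proof (rule cINF_greatest)
    show "admissible_paths T x y t \<noteq> {}"
      using u(1) admissible_paths_iff[OF tT] tT unfolding steers_def by fastforce
    fix \<gamma> assume "\<gamma> \<in> admissible_paths T x y t"
    then obtain v w where w: "trajectory t y v w" "x \<le> w T" "\<gamma> = restrict w {t..T}"
      using admissible_paths_iff[OF tT] by blast
    then show "energy t T u \<le> action b T t \<gamma>" using u(2) action_trajectory unfolding steers_def by auto
  qed
  then have "q b T x y t = energy t T u" using q_le_energy[OF tT u(1)] by simp
  then show thesis using u(1) that by blast
qed

end

section \<open>Convex functions depending on a parameter\<close>

text \<open>Convexity gives the lower bound \<open>g(a + h) - g(a) \<ge> g(a) - g(a - h)\<close>, so the difference quotient of \<open>g\<close>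
  lies between those of \<open>\<phi>\<close> at \<open>h\<close> and at \<open>- h\<close>.\<close>

lemma convex_touching_has_derivative:
  fixes g \<phi> :: "real \<Rightarrow> real"
  assumes conv: "convex_on UNIV g" and le: "\<And>h. g (a + h) \<le> \<phi> h" and eq: "g a = \<phi> 0"
    and der: "(\<phi> has_real_derivative D) (at 0)"
  shows "(g has_real_derivative D) (at a)"
proof -
  let ?up = "\<lambda>h. (\<phi> h - \<phi> 0) / h" and ?q = "\<lambda>h. (g (a + h) - g a) / h"
  have up: "(?up \<longlongrightarrow> D) (at 0)" using der by (simp add: has_field_derivative_iff)
  have "filterlim uminus (at 0) (at (0::real))"
    by (rule filterlim_atI) (auto intro!: tendsto_eq_intros simp: eventually_at_filter)
  from filterlim_compose[OF up this] have lo: "((\<lambda>h. ?up (- h)) \<longlongrightarrow> D) (at 0)" .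
  have low: "\<phi> 0 - \<phi> (- h) \<le> g (a + h) - g a" for h
  proof -
    have "(1 - 1/2) *\<^sub>R (a - h) + (1/2) *\<^sub>R (a + h) = a" by (simp add: field_simps)
    then have "g a \<le> 1/2 * g (a - h) + 1/2 * g (a + h)"
      using convex_onD[OF conv, of "1/2" "a - h" "a + h"] by simp
    then show ?thesis using le[of "- h"] eq by simp
  qed
  have "((\<lambda>h. ?q h - D) \<longlongrightarrow> 0) (at 0)"
  proof (rule Lim_null_comparison)
    show "((\<lambda>h. \<bar>?up h - D\<bar> + \<bar>?up (- h) - D\<bar>) \<longlongrightarrow> 0) (at 0)"
      using tendsto_add[OF tendsto_rabs[OF tendsto_diff[OF up tendsto_const[of D]]] tendsto_rabs[OF tendsto_diff[OF lo tendsto_const[of D]]]]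
      by simp
    have "norm (?q h - D) \<le> \<bar>?up h - D\<bar> + \<bar>?up (- h) - D\<bar>" if "h \<noteq> 0" for h
    proof (cases "h > 0")
      case True
      have "?q h \<le> ?up h" using le[of h] eq True by (intro divide_right_mono) auto
      moreover have "?up (- h) \<le> ?q h"
      proof -
        have "?up (- h) = (\<phi> 0 - \<phi> (- h)) / h" by (simp add: minus_divide_left)
        also have "\<dots> \<le> ?q h" using low[of h] True by (intro divide_right_mono) auto
        finally show ?thesis .
      qed
      ultimately show ?thesis by (simp add: abs_if)
    next
      case False
      then have h: "h < 0" using that by simp
      have "?up h \<le> ?q h" using le[of h] eq h by (intro divide_right_mono_neg) auto
      moreover have "?q h \<le> ?up (- h)"
      proof -
        have "?q h \<le> (\<phi> 0 - \<phi> (- h)) / h" using low[of h] h by (intro divide_right_mono_neg) auto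
        also have "\<dots> = ?up (- h)" by (simp add: minus_divide_left)
        finally show ?thesis .
      qed
      ultimately show ?thesis by (simp add: abs_if)
    qed
    then show "\<forall>\<^sub>F h in at 0. norm (?q h - D) \<le> \<bar>?up h - D\<bar> + \<bar>?up (- h) - D\<bar>"
      by (simp add: eventually_at_filter)
  qed
  then show ?thesis unfolding DERIV_def by (simp add: LIM_zero_iff)
qed

text \<open>Values at \<open>x0 - r\<close>, \<open>x0\<close> and \<open>x0 + r\<close> control a convex function on the whole interval between them:
  from above by interpolation, from below by reflection in \<open>x0\<close>. For these three points continuity in \<open>w\<close>
  suffices.\<close>

lemma separately_convex_jointly_continuous:
  fixes f :: "real \<Rightarrow> 'w::metric_space \<Rightarrow> real"
  assumes conv: "\<And>w. w \<in> W \<Longrightarrow> convex_on UNIV (\<lambda>x. f x w)"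
    and cont: "\<And>x. continuous_on W (f x)"
  shows "continuous_on (UNIV \<times> W) (\<lambda>(x, w). f x w)"
  unfolding continuous_on_def
proof
  fix p :: "real \<times> 'w" assume "p \<in> UNIV \<times> W"
  then obtain x0 w0 where p: "p = (x0, w0)" and w0: "w0 \<in> W" by auto
  let ?F = "at p within UNIV \<times> W"
  have evW: "\<forall>\<^sub>F q in ?F. snd q \<in> W"
    unfolding eventually_at_filter by (intro always_eventually) auto
  have limx: "(fst \<longlongrightarrow> x0) ?F" and limw: "(snd \<longlongrightarrow> w0) ?F"
    unfolding p by (auto intro!: tendsto_eq_intros)
  have lim: "((\<lambda>q. f x (snd q)) \<longlongrightarrow> f x w0) ?F" for x
    by (rule continuous_on_tendsto_compose[OF cont limw w0 evW])
  have "continuous_on UNIV (\<lambda>x. f x w0)" by (rule convex_on_continuous[OF open_UNIV conv[OF w0]])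
  then have c0: "((\<lambda>x. f x w0) \<longlongrightarrow> f x0 w0) (at x0)" by (simp add: continuous_on_def)
  show "((\<lambda>(x, w). f x w) \<longlongrightarrow> (case p of (x, w) \<Rightarrow> f x w)) ?F"
    unfolding p prod.case
  proof (rule tendstoI, unfold p[symmetric])
    fix e :: real assume e: "e > 0"
    obtain \<delta> where \<delta>: "\<delta> > 0" "\<And>x. x \<noteq> x0 \<Longrightarrow> \<bar>x - x0\<bar> < \<delta> \<Longrightarrow> \<bar>f x w0 - f x0 w0\<bar> < e / 5"
      using tendstoD[OF c0, of "e/5"] e by (auto simp: eventually_at dist_real_def)
    define r where "r = \<delta> / 2"
    have r: "r > 0" "\<bar>f (x0 + r) w0 - f x0 w0\<bar> < e/5" "\<bar>f (x0 - r) w0 - f x0 w0\<bar> < e/5"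
      using \<delta> by (auto simp: r_def)
    have ev: "\<forall>\<^sub>F q in ?F. \<bar>f x (snd q) - f x w0\<bar> < e/5" for x
      using tendstoD[OF lim, of "e/5"] e by (simp add: dist_real_def)
    have evx: "\<forall>\<^sub>F q in ?F. \<bar>fst q - x0\<bar> < r" using tendstoD[OF limx r(1)] by (simp add: dist_real_def)
    show "\<forall>\<^sub>F q in ?F. dist (case q of (x, w) \<Rightarrow> f x w) (f x0 w0) < e"
      using ev[of x0] ev[of "x0 + r"] ev[of "x0 - r"] evx evW
    proof eventually_elim
      case (elim q)
      obtain x w where q: "q = (x, w)" by fastforce
      have cv: "convex_on UNIV (\<lambda>x. f x w)" using conv elim q by simp
      have up: "f x' w < f x0 w0 + 2 * e / 5" if "\<bar>x' - x0\<bar> < r" for x'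
      proof -
        define \<theta> where "\<theta> = (x' - (x0 - r)) / (2 * r)"
        have \<theta>: "0 \<le> \<theta>" "\<theta> \<le> 1" using that r(1) unfolding \<theta>_def by (auto simp: abs_if split: if_splits)
        have "\<theta> * (2 * r) = x' - (x0 - r)" using r(1) by (simp add: \<theta>_def)
        then have "x' = (1 - \<theta>) * (x0 - r) + \<theta> * (x0 + r)" by (simp add: algebra_simps)
        then have "f x' w \<le> (1 - \<theta>) * f (x0 - r) w + \<theta> * f (x0 + r) w"
          using convex_onD[OF cv \<theta>, of "x0 - r" "x0 + r"] by simp
        also have "\<dots> < f x0 w0 + 2 * e / 5"
          using convex_bound_lt[of "f (x0 - r) w" "f x0 w0 + 2 * e / 5" "f (x0 + r) w" "1 - \<theta>" \<theta>] elim r \<theta> q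
          by (auto simp: abs_if split: if_splits)
        finally show ?thesis .
      qed
      have "f x0 w \<le> 1/2 * f x w + 1/2 * f (2 * x0 - x) w"
      proof -
        have "(1 - 1/2) *\<^sub>R x + (1/2) *\<^sub>R (2 * x0 - x) = x0" by (simp add: field_simps)
        then show ?thesis using convex_onD[OF cv, of "1/2" x "2 * x0 - x"] by simp
      qed
      moreover have "f (2 * x0 - x) w < f x0 w0 + 2 * e / 5" using up[of "2 * x0 - x"] elim q by auto
      moreover have "f x w < f x0 w0 + 2 * e / 5" using up[of x] elim q by auto
      moreover have "f x0 w > f x0 w0 - e / 5" using elim(1) e unfolding q snd_conv by linarith
      ultimately show ?case unfolding q by (simp add: dist_real_def abs_if)
    qed
  qed
qed

text \<open>The derivative of a convex function lies between its left and right difference quotients with a fixed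
  step, and these quotients are jointly continuous.\<close>

lemma convex_derivative_jointly_continuous:
  fixes f D :: "real \<Rightarrow> 'w::metric_space \<Rightarrow> real"
  assumes conv: "\<And>w. w \<in> W \<Longrightarrow> convex_on UNIV (\<lambda>x. f x w)"
    and der: "\<And>x w. w \<in> W \<Longrightarrow> ((\<lambda>x. f x w) has_real_derivative D x w) (at x)"
    and cont: "continuous_on (UNIV \<times> W) (\<lambda>(x, w). f x w)"
  shows "continuous_on (UNIV \<times> W) (\<lambda>(x, w). D x w)"
  unfolding continuous_on_def
proof
  fix p :: "real \<times> 'w" assume "p \<in> UNIV \<times> W"
  then obtain x0 w0 where p: "p = (x0, w0)" and w0: "w0 \<in> W" by auto
  let ?F = "at p within UNIV \<times> W"
  have evW: "\<forall>\<^sub>F q in ?F. snd q \<in> W"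
    unfolding eventually_at_filter by (intro always_eventually) auto
  have limx: "(fst \<longlongrightarrow> x0) ?F" and limw: "(snd \<longlongrightarrow> w0) ?F"
    unfolding p by (auto intro!: tendsto_eq_intros)
  have lim: "((\<lambda>q. f (fst q + h) (snd q)) \<longlongrightarrow> f (x0 + h) w0) ?F" for h
  proof -
    have "((\<lambda>q. (\<lambda>(x, w). f x w) (fst q + h, snd q)) \<longlongrightarrow> (\<lambda>(x, w). f x w) (x0 + h, w0)) ?F"
      using evW by (intro continuous_on_tendsto_compose[OF cont] tendsto_intros limx limw) (use w0 in auto)
    then show ?thesis by simp
  qed
  have quot: "((\<lambda>q. (f (fst q + h) (snd q) - f (fst q) (snd q)) / h) \<longlongrightarrow> (f (x0 + h) w0 - f x0 w0) / h) ?F" if "h \<noteq> 0" for h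
    using lim[of h] lim[of 0] that by (intro tendsto_intros) auto
  have tangent: "D x w * h \<le> f (x + h) w - f x w" if "w \<in> W" for x w h
    using convex_on_imp_above_tangent[OF conv[OF that] connected_UNIV _ _ der[OF that, of x], of "x + h"] by simp
  have d0: "((\<lambda>h. (f (x0 + h) w0 - f x0 w0) / h) \<longlongrightarrow> D x0 w0) (at 0)"
    using der[OF w0, of x0] by (simp add: DERIV_def)
  show "((\<lambda>(x, w). D x w) \<longlongrightarrow> (case p of (x, w) \<Rightarrow> D x w)) ?F"
    unfolding p prod.case
  proof (rule tendstoI, unfold p[symmetric])
    fix e :: real assume e: "e > 0"
    obtain \<delta> where \<delta>: "\<delta> > 0" "\<And>h. h \<noteq> 0 \<Longrightarrow> \<bar>h\<bar> < \<delta> \<Longrightarrow> \<bar>(f (x0 + h) w0 - f x0 w0) / h - D x0 w0\<bar> < e / 2"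
      using tendstoD[OF d0, of "e/2"] e by (auto simp: eventually_at dist_real_def)
    define r where "r = \<delta> / 2"
    have r: "r > 0" "\<bar>(f (x0 + r) w0 - f x0 w0) / r - D x0 w0\<bar> < e/2"
       "\<bar>(f (x0 + (- r)) w0 - f x0 w0) / (- r) - D x0 w0\<bar> < e/2"
      using \<delta>(1) \<delta>(2)[of r] \<delta>(2)[of "- r"] by (auto simp: r_def)
    have ev: "\<forall>\<^sub>F q in ?F. \<bar>(f (fst q + h) (snd q) - f (fst q) (snd q)) / h - (f (x0 + h) w0 - f x0 w0) / h\<bar> < e/2"
      if "h \<noteq> 0" for h
      using tendstoD[OF quot[OF that], of "e/2"] e by (simp add: dist_real_def)
    have "r \<noteq> 0" "- r \<noteq> 0" using r(1) by auto
    show "\<forall>\<^sub>F q in ?F. dist (case q of (x, w) \<Rightarrow> D x w) (D x0 w0) < e"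
      using ev[OF \<open>r \<noteq> 0\<close>] ev[OF \<open>- r \<noteq> 0\<close>] evW
    proof eventually_elim
      case (elim q)
      obtain x w where q: "q = (x, w)" by fastforce
      have "D x w \<le> (f (x + r) w - f x w) / r"
        using tangent[of w x r] elim q r(1) by (simp add: pos_le_divide_eq)
      moreover have "D x w \<ge> (f (x + (- r)) w - f x w) / (- r)"
        
      proof -
        have "(f (x + (- r)) w - f x w) / (- r) \<le> (D x w * (- r)) / (- r)"
          using tangent[of w x "- r"] elim(3) q r(1) by (intro divide_right_mono_neg) auto
        then show ?thesis using r(1) by simp
      qed
      ultimately show ?case using elim(1,2) r(2,3) unfolding q dist_real_def fst_conv snd_conv prod.case by linarith
    qed
  qed
qed

section \<open>The value function in space and over short times\<close>

locale concave_drift = lipschitz_drift +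
  fixes b' :: "real \<Rightarrow> real \<Rightarrow> real"
  assumes drift_derivative: "\<And>y s. s \<le> T \<Longrightarrow> ((\<lambda>z. b z s) has_real_derivative b' y s) (at y)"
    and concave_drift: "\<And>s. s \<le> T \<Longrightarrow> concave_on UNIV (\<lambda>y. b y s)"
begin

abbreviation Q :: "real \<Rightarrow> real \<Rightarrow> real \<Rightarrow> real" where "Q \<equiv> q b T"

lemma Q_attained:
  assumes "t < T"
  obtains u where "steers x y t u" "Q x y t = energy t T u"
  using q_attained[OF concave_drift assms] by auto

lemma Q_nonneg: "t < T \<Longrightarrow> 0 \<le> Q x y t"
  by (metis Q_attained energy_nonneg)

lemma Q_mix:
  assumes tT: "t < T" and \<theta>: "0 \<le> \<theta>" "\<theta> \<le> 1"
  shows "Q ((1 - \<theta>) * x0 + \<theta> * x1) ((1 - \<theta>) * y0 + \<theta> * y1) t \<le> (1 - \<theta>) * Q x0 y0 t + \<theta> * Q x1 y1 t"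
proof -
  obtain u0 where u0: "steers x0 y0 t u0" "Q x0 y0 t = energy t T u0" by (rule Q_attained[OF tT])
  obtain u1 where u1: "steers x1 y1 t u1" "Q x1 y1 t = energy t T u1" by (rule Q_attained[OF tT])
  have "Q ((1 - \<theta>) * x0 + \<theta> * x1) ((1 - \<theta>) * y0 + \<theta> * y1) t \<le> energy t T (\<lambda>s. (1 - \<theta>) * u0 s + \<theta> * u1 s)"
    by (intro q_le_energy[OF tT] steers_mix[OF concave_drift tT u0(1) u1(1) \<theta>]) auto
  also have "\<dots> \<le> (1 - \<theta>) * Q x0 y0 t + \<theta> * Q x1 y1 t"
    unfolding u0(2) u1(2) energy_mix[OF steers_square_integrable[OF u0(1)] steers_square_integrable[OF u1(1)]]
    using \<theta> energy_nonneg[of t T "\<lambda>s. u0 s - u1 s"] by simp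
  finally show ?thesis .
qed

lemma Q_convex_on_line:
  assumes "t < T"
  shows "convex_on UNIV (\<lambda>h. Q (x + h * c) (y + h * d) t)"
proof (rule convex_onI)
  fix \<theta> h k :: real assume "0 < \<theta>" "\<theta> < 1"
  then show "Q (x + ((1 - \<theta>) *\<^sub>R h + \<theta> *\<^sub>R k) * c) (y + ((1 - \<theta>) *\<^sub>R h + \<theta> *\<^sub>R k) * d) t
    \<le> (1 - \<theta>) * Q (x + h * c) (y + h * d) t + \<theta> * Q (x + k * c) (y + k * d) t"
    using Q_mix[OF assms, of \<theta> "x + h * c" "x + k * c" "y + h * d" "y + k * d"] by (simp add: algebra_simps)
qed simp

lemma Q_convex_terminal: "t < T \<Longrightarrow> convex_on UNIV (\<lambda>x. Q x y t)"
  using Q_convex_on_line[of t 0 1 y 0] by simp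

lemma Q_convex_initial: "t < T \<Longrightarrow> convex_on UNIV (\<lambda>y. Q x y t)"
  using Q_convex_on_line[of t x 0 0 1] by simp

text \<open>Adding \<open>h\<close> times the affine function \<open>c(s) = \<alpha> + \<beta> (s - t)\<close> to the optimal path moves its endpoints by
  \<open>h \<alpha>\<close> and \<open>h (\<alpha> + \<beta> (T - t))\<close> and its control by \<open>\<kappa> h\<close>. The energy \<open>\<phi>\<close> of the perturbed control is
  differentiable in \<open>h\<close> by dominated convergence, because \<open>\<kappa> h / h\<close> is bounded by \<open>\<bar>\<beta>\<bar> + A \<bar>c\<bar>\<close> and
  converges to \<open>\<beta> - b' c\<close>. It touches the convex function from above at \<open>h = 0\<close>.\<close>

lemma Q_differentiable_on_line:
  assumes tT: "t < T"
  shows "\<exists>D. ((\<lambda>h. Q (x + h * (\<alpha> + \<beta> * (T - t))) (y + h * \<alpha>) t) has_real_derivative D) (at 0)"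
proof -
  define c where "c = (\<lambda>s. \<alpha> + \<beta> * (s - t))"
  obtain u where u: "steers x y t u" "Q x y t = energy t T u" by (rule Q_attained[OF tT])
  then obtain z where z: "trajectory t y u z" "x \<le> z T" unfolding steers_def by blast
  note squ = trajectoryD(1)[OF z(1)]
  define \<kappa> where "\<kappa> = (\<lambda>h s. h * \<beta> - (b (z s + h * c s) s - b (z s) s))"
  define \<phi> where "\<phi> = (\<lambda>h. energy t T (\<lambda>s. u s + \<kappa> h s))"
  have cc: "continuous_on S c" for S unfolding c_def by (intro continuous_intros)
  have c\<kappa>: "continuous_on {t..T} (\<kappa> h)" for h
    unfolding \<kappa>_def by (intro continuous_intros cc trajectoryD(2)[OF z(1)]) auto
  have sq\<kappa>: "square_integrable_on {t..T} (\<kappa> h)" for h by (rule square_integrable_continuous[OF c\<kappa>])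
  have steer: "steers (x + h * (\<alpha> + \<beta> * (T - t))) (y + h * \<alpha>) t (\<lambda>s. u s + \<kappa> h s)" for h
  proof -
    let ?w = "\<lambda>s. z s + h * c s"
    have "trajectory t (y + h * \<alpha>) (\<lambda>s. ((b (z s) s + u s) + h * \<beta>) - b (?w s) s) ?w"
    proof (rule trajectory_of_density)
      show "square_integrable_on {t..T} (\<lambda>s. (b (z s) s + u s) + h * \<beta>)"
        by (intro square_integrable_add[OF trajectoryD(5)[OF z(1)]] square_integrable_continuous continuous_intros)
      fix s assume s: "s \<in> {t..T}"
      have "(\<lambda>s. b (z s) s + u s) integrable_on {t..s}"
        by (rule integrable_subinterval_real[OF square_integrable_integrable[OF trajectoryD(5)[OF z(1)]]]) (use s in auto)
      then have "integral {t..s} (\<lambda>s. (b (z s) s + u s) + h * \<beta>) = integral {t..s} (\<lambda>s. b (z s) s + u s) + integral {t..s} (\<lambda>s. h * \<beta>)"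
        by (rule integral_add[OF _ integrable_const_ivl])
      then show "z s + h * c s = y + h * \<alpha> + integral {t..s} (\<lambda>s. (b (z s) s + u s) + h * \<beta>)"
        using trajectoryD(3)[OF z(1) s] s by (simp add: c_def algebra_simps)
    qed
    moreover have "(\<lambda>s. ((b (z s) s + u s) + h * \<beta>) - b (?w s) s) = (\<lambda>s. u s + \<kappa> h s)"
      by (auto simp: \<kappa>_def)
    moreover have "x + h * (\<alpha> + \<beta> * (T - t)) \<le> z T + h * c T" using z(2) by (simp add: c_def)
    ultimately show ?thesis unfolding steers_def by auto
  qed
  have \<kappa>0: "\<kappa> 0 s = 0" for s by (simp add: \<kappa>_def)
  define K where "K = (\<lambda>s. \<bar>\<beta>\<bar> + A * \<bar>c s\<bar>)"
  have K: "\<bar>\<kappa> h s / h\<bar> \<le> K s" if "s \<in> {t..T}" "h \<noteq> 0" for h s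
  proof -
    have "\<bar>b (z s + h * c s) s - b (z s) s\<bar> \<le> A * \<bar>h * c s\<bar>"
      using lipschitz_drift[of s "z s + h * c s" "z s"] that by simp
    then have "\<bar>\<kappa> h s\<bar> \<le> \<bar>h * \<beta>\<bar> + A * \<bar>h * c s\<bar>" unfolding \<kappa>_def by linarith
    also have "\<dots> = K s * \<bar>h\<bar>" by (simp add: K_def abs_mult algebra_simps)
    finally show ?thesis using that by (simp add: pos_divide_le_eq)
  qed
  have cK: "continuous_on {t..T} K" unfolding K_def by (intro continuous_intros cc)
  have \<kappa>lim: "((\<lambda>h. \<kappa> h s / h) \<longlongrightarrow> \<beta> - b' (z s) s * c s) (at 0)" if "s \<in> {t..T}" for s
  proof -
    have "((\<lambda>h. z s + h * c s) has_real_derivative c s) (at 0)"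
      by (auto intro!: derivative_eq_intros)
    then have "((\<lambda>h. b (z s + h * c s) s) has_real_derivative b' (z s) s * c s) (at 0)"
      using DERIV_chain2[of "\<lambda>y. b y s" "b' (z s) s" "\<lambda>h. z s + h * c s" 0 "c s"] drift_derivative[of s "z s"] that by simp
    then have "((\<lambda>h. \<kappa> h s) has_real_derivative \<beta> - b' (z s) s * c s) (at 0)"
      unfolding \<kappa>_def by (auto intro!: derivative_eq_intros)
    then show ?thesis by (simp add: DERIV_def \<kappa>0)
  qed
  let ?D = "integral {t..T} (\<lambda>s. u s * (\<beta> - b' (z s) s * c s))"
  let ?g = "\<lambda>h s. u s * (\<kappa> h s / h) + h / 2 * (\<kappa> h s / h)\<^sup>2"
  have intg: "?g h integrable_on {t..T}" for h
    using square_integrable_mult_integrable[OF squ square_integrable_cmult[OF sq\<kappa>[of h], of "1/h"]]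
      square_integrable_integrable_power2[OF square_integrable_cmult[OF sq\<kappa>[of h], of "1/h"]]
    by (intro integrable_add integrable_on_mult_right) simp_all
  have quot: "(\<phi> h - \<phi> 0) / h = integral {t..T} (?g h)" if h: "h \<noteq> 0" for h
  proof -
    have i: "(\<lambda>s. (u s + \<kappa> h s)\<^sup>2) integrable_on {t..T}" "(\<lambda>s. (u s)\<^sup>2) integrable_on {t..T}"
      by (intro square_integrable_integrable_power2 square_integrable_add squ sq\<kappa>)+
    have "\<phi> h - \<phi> 0 = 1/2 * (integral {t..T} (\<lambda>s. (u s + \<kappa> h s)\<^sup>2) - integral {t..T} (\<lambda>s. (u s)\<^sup>2))"
      by (simp add: \<phi>_def energy_def \<kappa>0)
    also have "\<dots> = 1/2 * integral {t..T} (\<lambda>s. (u s + \<kappa> h s)\<^sup>2 - (u s)\<^sup>2)"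
      by (simp add: integral_diff[OF i])
    also have "(\<lambda>s. (u s + \<kappa> h s)\<^sup>2 - (u s)\<^sup>2) = (\<lambda>s. (2 * h) * ?g h s)"
      using h by (intro ext) (simp add: power2_eq_square field_simps)
    finally show ?thesis using h by simp
  qed
  have "(\<phi> has_real_derivative ?D) (at 0)"
    unfolding DERIV_def tendsto_at_iff_sequentially o_def
  proof (intro allI impI)
    fix X :: "nat \<Rightarrow> real" assume X0: "\<forall>i. X i \<in> UNIV - {0}" and X: "X \<longlonglongrightarrow> 0"
    obtain B where B: "\<And>i. \<bar>X i\<bar> \<le> B" using X convergent_imp_Bseq[of X] unfolding convergent_def Bseq_def by auto
    have "(\<lambda>i. integral {t..T} (?g (X i))) \<longlonglongrightarrow> ?D"
    proof (rule dominated_convergence(2)[where h = "\<lambda>s. \<bar>u s * K s\<bar> + B / 2 * (K s)\<^sup>2"])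
      show "?g (X i) integrable_on {t..T}" for i by (rule intg)
      have "(\<lambda>s. u s * K s) absolutely_integrable_on {t..T}"
        by (intro square_integrable_mult squ square_integrable_continuous cK)
      then have "(\<lambda>s. \<bar>u s * K s\<bar>) integrable_on {t..T}" by (simp add: absolutely_integrable_on_def)
      then show "(\<lambda>s. \<bar>u s * K s\<bar> + B / 2 * (K s)\<^sup>2) integrable_on {t..T}"
        by (rule integrable_add[OF _ integrable_continuous_real]) (intro continuous_intros cK)
      fix s assume s: "s \<in> {t..T}"
      show "norm (?g (X i) s) \<le> \<bar>u s * K s\<bar> + B / 2 * (K s)\<^sup>2" for i
      proof -
        have k: "\<bar>\<kappa> (X i) s / X i\<bar> \<le> K s" using K s X0 by auto
        have "\<bar>u s * (\<kappa> (X i) s / X i)\<bar> \<le> \<bar>u s\<bar> * \<bar>K s\<bar>"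
          unfolding abs_mult using k by (intro mult_left_mono) auto
        moreover have "\<bar>X i / 2 * (\<kappa> (X i) s / X i)\<^sup>2\<bar> \<le> B / 2 * (K s)\<^sup>2"
          unfolding abs_mult
        proof (intro mult_mono)
          show "\<bar>X i / 2\<bar> \<le> B / 2" "0 \<le> B / 2" using B[of i] by auto
          show "\<bar>(\<kappa> (X i) s / X i)\<^sup>2\<bar> \<le> (K s)\<^sup>2"
            using power_mono[OF k, of 2] by (simp only: power2_abs abs_power2 abs_ge_zero simp_thms)
        qed simp
        ultimately show ?thesis unfolding real_norm_def abs_mult[of "u s" "K s"] by linarith
      qed
      have "(\<lambda>i. \<kappa> (X i) s / X i) \<longlonglongrightarrow> \<beta> - b' (z s) s * c s"
        using \<kappa>lim[OF s] X0 X unfolding tendsto_at_iff_sequentially o_def by blast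
      then have "(\<lambda>i. ?g (X i) s) \<longlonglongrightarrow> u s * (\<beta> - b' (z s) s * c s) + 0 / 2 * (\<beta> - b' (z s) s * c s)\<^sup>2"
        by (intro tendsto_intros X) auto
      then show "(\<lambda>i. ?g (X i) s) \<longlonglongrightarrow> u s * (\<beta> - b' (z s) s * c s)" by simp
    qed
    then show "(\<lambda>i. (\<phi> (0 + X i) - \<phi> 0) / X i) \<longlonglongrightarrow> ?D"
      using quot X0 by simp
  qed
  then show ?thesis
    by (intro exI convex_touching_has_derivative[OF Q_convex_on_line[OF tT]])
       (use q_le_energy[OF tT steer] u(2) in \<open>auto simp: \<phi>_def \<kappa>0\<close>)
qed

definition Qx :: "real \<Rightarrow> real \<Rightarrow> real \<Rightarrow> real" where "Qx x y t = deriv (\<lambda>x. Q x y t) x"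
definition Qy :: "real \<Rightarrow> real \<Rightarrow> real \<Rightarrow> real" where "Qy x y t = deriv (\<lambda>y. Q x y t) y"

text \<open>The affine perturbation that fixes the initial point and moves the terminal one.\<close>

lemma Q_has_derivative_terminal:
  assumes tT: "t < T"
  shows "((\<lambda>x. Q x y t) has_real_derivative Qx x y t) (at x)"
proof -
  have "0 + 1 / (T - t) * (T - t) = 1" using tT by simp
  with Q_differentiable_on_line[OF tT, of x 0 "1 / (T - t)" y]
  obtain D where "((\<lambda>h. Q (x + h) y t) has_real_derivative D) (at 0)" by auto
  then have "((\<lambda>x. Q x y t) has_real_derivative D) (at x)" by (simp add: DERIV_def)
  then show ?thesis unfolding Qx_def using DERIV_imp_deriv by metis
qed

text \<open>The affine perturbation that fixes the terminal point and moves the initial one.\<close>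

lemma Q_has_derivative_initial:
  assumes tT: "t < T"
  shows "((\<lambda>y. Q x y t) has_real_derivative Qy x y t) (at y)"
proof -
  have "1 + (- 1 / (T - t)) * (T - t) = 0" using tT by simp
  with Q_differentiable_on_line[OF tT, of x 1 "- 1 / (T - t)" y]
  obtain D where "((\<lambda>h. Q x (y + h) t) has_real_derivative D) (at 0)" by auto
  then have "((\<lambda>y. Q x y t) has_real_derivative D) (at y)" by (simp add: DERIV_def)
  then show ?thesis unfolding Qy_def using DERIV_imp_deriv by metis
qed

lemma Q_above_tangent:
  assumes tT: "t < T"
  shows "Q x y t + Qy x y t * (y1 - y) \<le> Q x y1 t"
  using convex_on_imp_above_tangent[OF Q_convex_initial[OF tT] connected_UNIV _ _ Q_has_derivative_initial[OF tT], of y y1 x] by simp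

lemma trajectory_restart:
  assumes z: "trajectory t1 y u z" and t: "t1 \<le> t2" "t2 \<le> T"
  shows "trajectory t2 (z t2) u z"
  unfolding trajectory_def
proof (intro conjI ballI)
  have sub: "{t2..T} \<subseteq> {t1..T}" using t by auto
  show "square_integrable_on {t2..T} u" by (rule square_integrable_subinterval[OF trajectoryD(1)[OF z] sub])
  show "continuous_on {t2..T} z" by (rule continuous_on_subset[OF trajectoryD(2)[OF z] sub])
  fix s assume "s \<in> {t2..T}"
  then show "z s = z t2 + integral {t2..s} (\<lambda>r. b (z r) r + u r)"
    using trajectory_increment[OF z t(1), of s] by simp
qed

text \<open>Move with constant velocity \<open>v\<close> until \<open>t2\<close>, then continue optimally.\<close>

lemma Q_le_delayed_start:
  assumes t: "t1 < t2" "t2 < T"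
  shows "Q x y t1 \<le> 1/2 * integral {t1..t2} (\<lambda>s. (v - b (y + v * (s - t1)) s)\<^sup>2) + Q x (y + v * (t2 - t1)) t2"
proof -
  obtain u where u: "steers x (y + v * (t2 - t1)) t2 u" "Q x (y + v * (t2 - t1)) t2 = energy t2 T u"
    by (rule Q_attained[OF t(2)])
  then obtain z where z: "trajectory t2 (y + v * (t2 - t1)) u z" "x \<le> z T" unfolding steers_def by blast
  define f where "f = (\<lambda>s. if s < t2 then v else b (z s) s + u s)"
  define w where "w = (\<lambda>s. if s < t2 then y + v * (s - t1) else z s)"
  have neg: "negligible {t2}" by simp
  have sqf: "square_integrable_on {t1..T} f"
    unfolding f_def using t by (intro square_integrable_join trajectoryD(5)[OF z(1)] square_integrable_continuous) auto
  have wT: "trajectory t1 y (\<lambda>s. f s - b (w s) s) w"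
  proof (rule trajectory_of_density[OF sqf])
    fix s assume s: "s \<in> {t1..T}"
    show "w s = y + integral {t1..s} f"
    proof (cases "s < t2")
      case True
      then have "integral {t1..s} f = integral {t1..s} (\<lambda>_. v)" by (intro integral_cong) (auto simp: f_def)
      then show ?thesis using True s by (simp add: w_def mult.commute)
    next
      case False
      have "integral {t1..s} f = integral {t1..t2} f + integral {t2..s} f"
        using s False t by (intro integral_split_at integrable_subinterval_real[OF square_integrable_integrable[OF sqf]]) auto
      also have "integral {t1..t2} f = integral {t1..t2} (\<lambda>_. v)"
        by (rule integral_spike[OF neg]) (auto simp: f_def)
      also have "integral {t2..s} f = integral {t2..s} (\<lambda>s. b (z s) s + u s)"
        by (intro integral_cong) (auto simp: f_def)
      finally show ?thesis using False s t trajectoryD(3)[OF z(1), of s] by (simp add: w_def mult.commute)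
    qed
  qed
  then have "Q x y t1 \<le> energy t1 T (\<lambda>s. f s - b (w s) s)"
    using z(2) t by (intro q_le_energy) (auto simp: steers_def w_def intro!: exI[of _ w])
  also have "\<dots> = 1/2 * (integral {t1..t2} (\<lambda>s. (f s - b (w s) s)\<^sup>2) + integral {t2..T} (\<lambda>s. (f s - b (w s) s)\<^sup>2))"
    unfolding energy_def using t
    by (subst integral_split_at[OF square_integrable_integrable_power2[OF trajectoryD(1)[OF wT]], of t2]) auto
  also have "integral {t1..t2} (\<lambda>s. (f s - b (w s) s)\<^sup>2) = integral {t1..t2} (\<lambda>s. (v - b (y + v * (s - t1)) s)\<^sup>2)"
    by (rule integral_spike[OF neg]) (auto simp: f_def w_def)
  also have "integral {t2..T} (\<lambda>s. (f s - b (w s) s)\<^sup>2) = integral {t2..T} (\<lambda>s. (u s)\<^sup>2)"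
    by (intro integral_cong) (auto simp: f_def w_def)
  finally show ?thesis unfolding u(2) energy_def by simp
qed

text \<open>The constant path \<open>y\<close> has control \<open>- b y\<close>, so stability and the Cauchy-Schwarz inequality bound the
  distance to it by the square root of the elapsed time.\<close>

lemma trajectory_initial_drift:
  assumes z: "trajectory t1 y u z" and t: "t1 < t2" "t2 \<le> T" and r: "r \<in> {t1..t2}"
  shows "\<bar>z r - y\<bar> \<le> sqrt ((t2 - t1) * (4 * energy t1 T u + 2 * integral {t1..T} (\<lambda>s. (b y s)\<^sup>2))) * exp (A * (T - t1))"
proof -
  have "trajectory t1 y (\<lambda>s. 0 - b y s) (\<lambda>_. y)"
    by (rule trajectory_of_density) (auto intro!: square_integrable_continuous)
  from trajectory_stability_upto[OF z this, of r] r t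
  have "\<bar>z r - y\<bar> \<le> integral {t1..r} (\<lambda>s. \<bar>u s + b y s\<bar>) * exp (A * (T - t1))" by simp
  also have "\<dots> \<le> sqrt ((t2 - t1) * (4 * energy t1 T u + 2 * integral {t1..T} (\<lambda>s. (b y s)\<^sup>2))) * exp (A * (T - t1))"
  proof (rule mult_right_mono)
    have cb: "continuous_on {t1..T} (\<lambda>s. b y s)" by (intro continuous_intros) auto
    have sq: "square_integrable_on {t1..T} (\<lambda>s. u s + b y s)"
      by (intro square_integrable_add trajectoryD(1)[OF z] square_integrable_continuous cb)
    have sq2: "square_integrable_on {t1..t2} (\<lambda>s. u s + b y s)"
      by (rule square_integrable_subinterval[OF sq]) (use t in auto)
    have "integral {t1..r} (\<lambda>s. \<bar>u s + b y s\<bar>) \<le> integral {t1..t2} (\<lambda>s. \<bar>u s + b y s\<bar>)"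
      using r by (intro integral_subset_le integrable_subinterval_real[OF square_integrable_abs_integrable[OF sq2]]) auto
    also have "\<dots> \<le> sqrt ((t2 - t1) * integral {t1..t2} (\<lambda>s. (u s + b y s)\<^sup>2))"
      by (rule integral_abs_le_sqrt[OF sq2 t(1)])
    also have "\<dots> \<le> sqrt ((t2 - t1) * (4 * energy t1 T u + 2 * integral {t1..T} (\<lambda>s. (b y s)\<^sup>2)))"
    proof (intro real_sqrt_le_mono mult_left_mono)
      have i: "(\<lambda>s. (u s)\<^sup>2) integrable_on {t1..T}" "(\<lambda>s. (b y s)\<^sup>2) integrable_on {t1..T}" "(\<lambda>s. (u s + b y s)\<^sup>2) integrable_on {t1..T}"
        using trajectoryD(1)[OF z] square_integrable_continuous[OF cb] sq by (auto intro: square_integrable_integrable_power2)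
      have "integral {t1..t2} (\<lambda>s. (u s + b y s)\<^sup>2) \<le> integral {t1..T} (\<lambda>s. (u s + b y s)\<^sup>2)"
        using t by (intro integral_subset_le integrable_subinterval_real[OF i(3)] i(3)) auto
      also have "\<dots> \<le> integral {t1..T} (\<lambda>s. 2 * (u s)\<^sup>2 + 2 * (b y s)\<^sup>2)"
      proof (intro integral_le integrable_add integrable_on_mult_right i)
        fix s show "(u s + b y s)\<^sup>2 \<le> 2 * (u s)\<^sup>2 + 2 * (b y s)\<^sup>2"
          using sum_squares_bound[of "u s" "b y s"] by (simp add: power2_sum)
      qed
      also have "\<dots> = 2 * integral {t1..T} (\<lambda>s. (u s)\<^sup>2) + 2 * integral {t1..T} (\<lambda>s. (b y s)\<^sup>2)"
        by (intro integral_unique has_integral_add has_integral_mult_right integrable_integral i)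
      finally show "integral {t1..t2} (\<lambda>s. (u s + b y s)\<^sup>2) \<le> 4 * energy t1 T u + 2 * integral {t1..T} (\<lambda>s. (b y s)\<^sup>2)"
        by (simp add: energy_def)
    qed (use t in auto)
    finally show "integral {t1..r} (\<lambda>s. \<bar>u s + b y s\<bar>) \<le> sqrt ((t2 - t1) * (4 * energy t1 T u + 2 * integral {t1..T} (\<lambda>s. (b y s)\<^sup>2)))" .
  qed simp
  finally show ?thesis .
qed

text \<open>The optimal path is cut at \<open>t2\<close>, and \<open>Q\<close> at time \<open>t2\<close> is bounded below by its tangent at \<open>y\<close>, of slope
  \<open>m\<close>. Over \<open>[t1, t2]\<close> the velocity is \<open>b(z) + u\<close>; completing the square, \<open>u\<^sup>2/2 + m u \<ge> - m\<^sup>2/2\<close>. The last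
  term on the left pays for replacing \<open>b(z(r), r)\<close> by \<open>b(y, r)\<close>; it is of order \<open>3/2\<close> in \<open>t2 - t1\<close>.\<close>

lemma Q_ge_delayed_start:
  assumes t: "t1 < t2" "t2 < T"
    and R: "4 * Q x y t1 + 2 * integral {t1..T} (\<lambda>s. (b y s)\<^sup>2) \<le> R" "exp (A * (T - t1)) \<le> E"
  defines "m \<equiv> Qy x y t2"
  shows "Q x y t2 - m\<^sup>2 / 2 * (t2 - t1) + m * integral {t1..t2} (b y)
      - \<bar>m\<bar> * A * (sqrt ((t2 - t1) * R) * E) * (t2 - t1) \<le> Q x y t1"
proof -
  have t1T: "t1 < T" using t by simp
  obtain u where u: "steers x y t1 u" "Q x y t1 = energy t1 T u"
    by (rule Q_attained[OF t1T])
  then obtain z where z: "trajectory t1 y u z" "x \<le> z T" unfolding steers_def by blast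
  define \<eta> where "\<eta> = sqrt ((t2 - t1) * R) * E"
  have \<eta>: "\<bar>z r - y\<bar> \<le> \<eta>" if "r \<in> {t1..t2}" for r
  proof -
    have "\<bar>z r - y\<bar> \<le> sqrt ((t2 - t1) * (4 * Q x y t1 + 2 * integral {t1..T} (\<lambda>s. (b y s)\<^sup>2))) * exp (A * (T - t1))"
      unfolding u(2) by (rule trajectory_initial_drift[OF z(1) t(1) _ that]) (use t in simp)
    also have "\<dots> \<le> \<eta>"
      unfolding \<eta>_def using R t Q_nonneg[OF t1T, of x y] integral_nonneg_total[of "{t1..T}" "\<lambda>s. (b y s)\<^sup>2"]
      by (intro mult_mono real_sqrt_le_mono mult_left_mono) auto
    finally show ?thesis .
  qed
  have sqz: "square_integrable_on {t1..t2} u"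
    by (rule square_integrable_subinterval[OF trajectoryD(1)[OF z(1)]]) (use t in auto)
  have cz: "continuous_on {t1..t2} (\<lambda>r. b (z r) r)" "continuous_on {t1..t2} (b y)"
    using t by (auto intro!: continuous_on_subset[OF trajectoryD(4)[OF z(1)]] continuous_intros)
  have i: "u integrable_on {t1..t2}" "(\<lambda>s. (u s)\<^sup>2) integrable_on {t1..t2}"
    "(\<lambda>r. b (z r) r) integrable_on {t1..t2}" "b y integrable_on {t1..t2}"
    using sqz cz by (auto intro: square_integrable_integrable square_integrable_integrable_power2 integrable_continuous_real)
  have "Q x (z t2) t2 \<le> energy t2 T u"
    using trajectory_restart[OF z(1), of t2] z(2) t by (intro q_le_energy) (auto simp: steers_def)
  moreover have "Q x y t1 = 1/2 * integral {t1..t2} (\<lambda>s. (u s)\<^sup>2) + energy t2 T u"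
    unfolding u(2) energy_def using t
    by (subst integral_split_at[OF square_integrable_integrable_power2[OF trajectoryD(1)[OF z(1)]], of t2]) auto
  moreover have "Q x y t2 + m * (z t2 - y) \<le> Q x (z t2) t2"
    unfolding m_def by (rule Q_above_tangent[OF t(2)])
  moreover have "z t2 - y = integral {t1..t2} (\<lambda>r. b (z r) r) + integral {t1..t2} u"
    using trajectoryD(3)[OF z(1), of t2] integral_add[OF i(3,1)] t by simp
  moreover have "- m\<^sup>2 / 2 * (t2 - t1) \<le> 1/2 * integral {t1..t2} (\<lambda>s. (u s)\<^sup>2) + m * integral {t1..t2} u"
  proof -
    have "((\<lambda>s. 1/2 * (u s)\<^sup>2 + m * u s + m\<^sup>2 / 2) has_integral
       1/2 * integral {t1..t2} (\<lambda>s. (u s)\<^sup>2) + m * integral {t1..t2} u + (t2 - t1) *\<^sub>R (m\<^sup>2 / 2)) {t1..t2}"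
      using t has_integral_const_real[of "m\<^sup>2 / 2" t1 t2]
      by (intro has_integral_add has_integral_mult_right integrable_integral i) simp
    moreover have "0 \<le> 1/2 * (u s)\<^sup>2 + m * u s + m\<^sup>2 / 2" for s
      using zero_le_power2[of "u s + m"] unfolding power2_sum by (simp add: mult.commute)
    ultimately have "0 \<le> 1/2 * integral {t1..t2} (\<lambda>s. (u s)\<^sup>2) + m * integral {t1..t2} u + (t2 - t1) *\<^sub>R (m\<^sup>2 / 2)"
      by (rule has_integral_nonneg)
    then show ?thesis by (simp add: algebra_simps)
  qed
  moreover have "m * integral {t1..t2} (b y) - \<bar>m\<bar> * A * \<eta> * (t2 - t1) \<le> m * integral {t1..t2} (\<lambda>r. b (z r) r)"
  proof -
    have "\<bar>integral {t1..t2} (\<lambda>r. b (z r) r - b y r)\<bar> \<le> integral {t1..t2} (\<lambda>r. A * \<eta>)"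
      unfolding real_norm_def[symmetric]
    proof (intro integral_norm_bound_integral integrable_diff i)
      fix r assume r: "r \<in> {t1..t2}"
      have "\<bar>b (z r) r - b y r\<bar> \<le> A * \<bar>z r - y\<bar>" using lipschitz_drift[of r "z r" y] r t by auto
      also have "\<dots> \<le> A * \<eta>" using \<eta>[OF r] A_nonneg by (intro mult_left_mono) auto
      finally show "norm (b (z r) r - b y r) \<le> A * \<eta>" by simp
    qed (rule integrable_const_ivl)
    then have le: "\<bar>integral {t1..t2} (\<lambda>r. b (z r) r) - integral {t1..t2} (b y)\<bar> \<le> A * \<eta> * (t2 - t1)"
      using t by (simp add: integral_diff[OF i(3,4)] mult_ac)
    have "\<bar>m * (integral {t1..t2} (\<lambda>r. b (z r) r) - integral {t1..t2} (b y))\<bar> \<le> \<bar>m\<bar> * (A * \<eta> * (t2 - t1))"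
      unfolding abs_mult by (intro mult_left_mono le) auto
    then show ?thesis by (simp add: abs_le_iff right_diff_distrib mult.assoc)
  qed
  ultimately show ?thesis unfolding \<eta>_def[symmetric] by (simp add: distrib_left)
qed

end

section \<open>Time derivative and continuous differentiability\<close>

text \<open>The minimum and maximum let one statement serve both sides of \<open>t\<close>; the second argument of \<open>G\<close> is the
  left endpoint of the interval.\<close>

lemma interval_average_tendsto:
  fixes G :: "real \<Rightarrow> real \<Rightarrow> real"
  assumes cont: "continuous_on ({..<T} \<times> {..<T}) (\<lambda>(s, \<tau>). G s \<tau>)" and t: "t < T"
  shows "((\<lambda>r. integral {min r t..max r t} (\<lambda>s. G s (min r t)) / \<bar>r - t\<bar>) \<longlongrightarrow> G t t) (at t)"
proof (rule tendstoI)
  fix e :: real assume e: "e > 0"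
  have "open ({..<T} \<times> {..<T})" by (intro open_Times) auto
  then have "isCont (\<lambda>(s, \<tau>). G s \<tau>) (t, t)" using cont t by (auto simp: continuous_on_eq_continuous_at)
  then obtain d where d: "d > 0" "\<And>q. dist q (t, t) < d \<Longrightarrow> dist ((\<lambda>(s, \<tau>). G s \<tau>) q) (G t t) < e / 2"
    unfolding continuous_at_eps_delta using e half_gt_zero[OF e] by (metis case_prod_conv)
  define \<delta> where "\<delta> = min (d / 2) (T - t)"
  have \<delta>: "\<delta> > 0" using d t by (simp add: \<delta>_def)
  have G: "\<bar>G s \<tau> - G t t\<bar> < e / 2" if "\<bar>s - t\<bar> < \<delta>" "\<bar>\<tau> - t\<bar> < \<delta>" for s \<tau>
  proof -
    have "dist (s, \<tau>) (t, t) \<le> \<bar>s - t\<bar> + \<bar>\<tau> - t\<bar>"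
      unfolding dist_Pair_Pair dist_real_def by (rule sqrt_sum_squares_le_sum_abs[THEN order_trans]) simp
    also have "\<dots> < d" using that unfolding \<delta>_def by linarith
    finally show ?thesis using d(2)[of "(s, \<tau>)"] by (simp add: dist_real_def)
  qed
  have "dist (integral {min r t..max r t} (\<lambda>s. G s (min r t)) / \<bar>r - t\<bar>) (G t t) < e"
    if r: "r \<noteq> t" "\<bar>r - t\<bar> < \<delta>" for r
  proof -
    let ?I = "{min r t..max r t}" and ?g = "\<lambda>s. G s (min r t)"
    have h: "\<bar>r - t\<bar> > 0" using r by simp
    have lT: "max r t < T" "min r t < T" using r unfolding \<delta>_def by auto
    have "continuous_on ?I ?g"
    proof -
      have "continuous_on ?I (\<lambda>s. (\<lambda>(s, \<tau>). G s \<tau>) (s, min r t))"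
        by (rule continuous_on_compose2[OF cont]) (use lT in \<open>auto intro!: continuous_intros\<close>)
      then show ?thesis by simp
    qed
    then have i: "?g integrable_on ?I" by (rule integrable_continuous_real)
    have "integral ?I ?g - G t t * \<bar>r - t\<bar> = integral ?I (\<lambda>s. ?g s - G t t)"
      using integral_diff[OF i integrable_const_ivl, of "G t t"] by (simp add: max_def min_def mult.commute)
    moreover have "norm (integral ?I (\<lambda>s. ?g s - G t t)) \<le> integral ?I (\<lambda>s. e / 2)"
    proof (rule integral_norm_bound_integral)
      show "(\<lambda>s. ?g s - G t t) integrable_on ?I" by (intro integrable_diff i integrable_const_ivl)
      show "(\<lambda>s. e / 2) integrable_on ?I" by (rule integrable_const_ivl)
      fix s assume "s \<in> ?I"
      then have "\<bar>s - t\<bar> < \<delta>" "\<bar>min r t - t\<bar> < \<delta>" using r by auto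
      from G[OF this] show "norm (?g s - G t t) \<le> e / 2" by simp
    qed
    moreover have "integral ?I (\<lambda>s. e / 2) = e / 2 * \<bar>r - t\<bar>"
      by (cases "r \<le> t") (simp_all add: max_def min_def)
    ultimately have "\<bar>integral ?I ?g - G t t * \<bar>r - t\<bar>\<bar> \<le> e / 2 * \<bar>r - t\<bar>"
      by (simp only: real_norm_def)
    moreover have "integral ?I ?g / \<bar>r - t\<bar> - G t t = (integral ?I ?g - G t t * \<bar>r - t\<bar>) / \<bar>r - t\<bar>"
      using h by (simp add: diff_divide_distrib)
    ultimately have "\<bar>integral ?I ?g / \<bar>r - t\<bar> - G t t\<bar> \<le> e / 2"
      using h by (simp add: pos_divide_le_eq)
    then show ?thesis using e by (simp add: dist_real_def)
  qed
  then show "\<forall>\<^sub>F r in at t. dist (integral {min r t..max r t} (\<lambda>s. G s (min r t)) / \<bar>r - t\<bar>) (G t t) < e"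
    unfolding eventually_at dist_real_def using \<delta> by blast
qed

context concave_drift begin

lemma Q_bounded_earlier:
  assumes "a \<le> t" "t \<le> c" "c < T"
  shows "Q x y t \<le> 1/2 * integral {a..c} (\<lambda>s. (b y s)\<^sup>2) + Q x y c"
proof (cases "t = c")
  case True
  then show ?thesis by (simp add: integral_nonneg_total)
next
  case False
  have cb: "continuous_on {a..c} (\<lambda>s. (b y s)\<^sup>2)" using assms by (intro continuous_intros) auto
  have "Q x y t \<le> 1/2 * integral {t..c} (\<lambda>s. (0 - b (y + 0 * (s - t)) s)\<^sup>2) + Q x (y + 0 * (c - t)) c"
    using False assms by (intro Q_le_delayed_start) auto
  moreover have "integral {t..c} (\<lambda>s. (b y s)\<^sup>2) \<le> integral {a..c} (\<lambda>s. (b y s)\<^sup>2)"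
    using assms by (intro integral_subset_le integrable_continuous_real continuous_on_subset[OF cb] cb) auto
  ultimately show ?thesis by simp
qed

text \<open>The upper bound is the cost of waiting at \<open>y\<close>. For the lower bound the slope of \<open>Q\<close> in \<open>y\<close> has to be
  bounded uniformly in time; by convexity it is bounded by the values at \<open>y + 1\<close> and \<open>y - 1\<close>, which are
  controlled by those at the later time \<open>c\<close>.\<close>

lemma Q_locally_lipschitz_time:
  assumes c: "c < T"
  shows "\<exists>C. \<forall>t1 t2. a \<le> t1 \<longrightarrow> t1 < t2 \<longrightarrow> t2 \<le> c \<longrightarrow> \<bar>Q x y t1 - Q x y t2\<bar> \<le> C * (t2 - t1)"
proof -
  define M where "M = (\<lambda>y. 1/2 * integral {a..c} (\<lambda>s. (b y s)\<^sup>2) + Q x y c)"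
  have M: "Q x y t \<le> M y" if "a \<le> t" "t \<le> c" for t y
    unfolding M_def using Q_bounded_earlier that c by blast
  have M0: "0 \<le> M y" for y
    unfolding M_def using Q_nonneg[OF c] by (simp add: integral_nonneg_total)
  define K where "K = M (y + 1) + M (y - 1)"
  have m: "\<bar>Qy x y t\<bar> \<le> K" if t: "a \<le> t" "t \<le> c" for t
  proof -
    have tT: "t < T" using t c by simp
    have "Qy x y t \<le> M (y + 1)" "- Qy x y t \<le> M (y - 1)"
      using Q_above_tangent[OF tT, of x y "y + 1"] Q_above_tangent[OF tT, of x y "y - 1"]
        Q_nonneg[OF tT, of x y] M[OF t, of "y + 1"] M[OF t, of "y - 1"] by auto
    then show ?thesis using M0[of "y + 1"] M0[of "y - 1"] unfolding K_def by linarith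
  qed
  have cbT: "continuous_on {a..T} (b y)" by (intro continuous_intros) auto
  have "bounded (b y ` {a..T})" by (intro compact_imp_bounded compact_continuous_image cbT compact_Icc)
  then obtain B where "\<forall>z\<in>b y ` {a..T}. norm z \<le> B" unfolding bounded_iff by blast
  then have B: "\<bar>b y s\<bar> \<le> B" if "s \<in> {a..T}" for s using that by simp
  define E where "E = exp (A * (T - a))"
  define R where "R = 4 * M y + 2 * integral {a..T} (\<lambda>s. (b y s)\<^sup>2)"
  define S where "S = sqrt ((c - a) * R) * E"
  define C where "C = K\<^sup>2 / 2 + K * B + K * A * S + B\<^sup>2 / 2"
  have "\<bar>Q x y t1 - Q x y t2\<bar> \<le> C * (t2 - t1)" if t: "a \<le> t1" "t1 < t2" "t2 \<le> c" for t1 t2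
  proof -
    have t2T: "t2 < T" using t c by simp
    have B0: "B \<ge> 0" using B[of T] t t2T by auto
    have K0: "K \<ge> 0" using m[of t2] t by auto
    have sub: "{t1..t2} \<subseteq> {a..T}" using t t2T by auto
    have cb: "continuous_on {t1..t2} (b y)" by (rule continuous_on_subset[OF cbT sub])
    have int_b: "\<bar>integral {t1..t2} (b y)\<bar> \<le> B * (t2 - t1)"
      using integral_bound[OF less_imp_le[OF t(2)] cb, of B] B sub by auto
    have int_b2: "\<bar>integral {t1..t2} (\<lambda>s. (b y s)\<^sup>2)\<bar> \<le> B\<^sup>2 * (t2 - t1)"
    proof -
      have "continuous_on {t1..t2} (\<lambda>s. (b y s)\<^sup>2)" by (intro continuous_on_power cb)
      moreover have "norm ((b y s)\<^sup>2) \<le> B\<^sup>2" if "s \<in> {t1..t2}" for s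
        using power_mono[OF B[of s], of 2] that sub by auto
      ultimately show ?thesis
        using integral_bound[OF less_imp_le[OF t(2)], of "\<lambda>s. (b y s)\<^sup>2" "B\<^sup>2"] by simp
    qed
    have up: "Q x y t1 - Q x y t2 \<le> B\<^sup>2 / 2 * (t2 - t1)"
      using Q_le_delayed_start[OF t(2) t2T, of x y 0] int_b2 by simp
    have R1: "4 * Q x y t1 + 2 * integral {t1..T} (\<lambda>s. (b y s)\<^sup>2) \<le> R"
    proof -
      have cb2: "continuous_on {a..T} (\<lambda>s. (b y s)\<^sup>2)" by (intro continuous_intros) auto
      have "integral {t1..T} (\<lambda>s. (b y s)\<^sup>2) \<le> integral {a..T} (\<lambda>s. (b y s)\<^sup>2)"
        using t by (intro integral_subset_le integrable_continuous_real continuous_on_subset[OF cb2] cb2) auto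
      then show ?thesis unfolding R_def using M[of t1 y] t by simp
    qed
    have E1: "exp (A * (T - t1)) \<le> E" unfolding E_def using A_nonneg t by (simp add: mult_left_mono)
    let ?m = "Qy x y t2"
    have mK: "\<bar>?m\<bar> \<le> K" using m t by simp
    have R0: "R \<ge> 0" unfolding R_def using M0 by (simp add: integral_nonneg_total)
    have S1: "sqrt ((t2 - t1) * R) * E \<le> S"
      unfolding S_def using t R0 by (intro mult_right_mono real_sqrt_le_mono) (auto simp: E_def)
    have S0: "0 \<le> sqrt ((t2 - t1) * R) * E" using t R0 by (simp add: E_def)
    have 1: "?m\<^sup>2 / 2 * (t2 - t1) \<le> K\<^sup>2 / 2 * (t2 - t1)"
      using power_mono[OF mK, of 2] t by (intro mult_right_mono) auto
    have 2: "\<bar>?m * integral {t1..t2} (b y)\<bar> \<le> K * (B * (t2 - t1))"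
      unfolding abs_mult using mK int_b K0 by (intro mult_mono) auto
    have 3: "\<bar>?m\<bar> * A * (sqrt ((t2 - t1) * R) * E) * (t2 - t1) \<le> K * A * S * (t2 - t1)"
      using mK S1 S0 A_nonneg K0 t by (intro mult_right_mono mult_mono) auto
    have lo: "- (K\<^sup>2 / 2 * (t2 - t1) + K * (B * (t2 - t1)) + K * A * S * (t2 - t1)) \<le> Q x y t1 - Q x y t2"
      using Q_ge_delayed_start[OF t(2) t2T R1 E1] 1 2 3 by linarith
    have pos: "0 \<le> B\<^sup>2 / 2 * (t2 - t1)" "0 \<le> K\<^sup>2 / 2 * (t2 - t1)" "0 \<le> K * (B * (t2 - t1))" "0 \<le> K * A * S * (t2 - t1)"
      using t K0 B0 A_nonneg S1 S0 by auto
    have "C * (t2 - t1) = K\<^sup>2 / 2 * (t2 - t1) + K * (B * (t2 - t1)) + K * A * S * (t2 - t1) + B\<^sup>2 / 2 * (t2 - t1)"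
      by (simp add: C_def algebra_simps)
    then show ?thesis using lo up pos by linarith
  qed
  then show ?thesis by blast
qed

lemma Q_continuous_time: "continuous_on {..<T} (Q x y)"
proof -
  have "isCont (Q x y) t" if t: "t < T" for t
  proof -
    define a c where "a = t - 1" and "c = (t + T) / 2"
    have c: "c < T" "a < t" "t < c" using t by (auto simp: a_def c_def)
    obtain C where C: "\<And>t1 t2. a \<le> t1 \<Longrightarrow> t1 < t2 \<Longrightarrow> t2 \<le> c \<Longrightarrow> \<bar>Q x y t1 - Q x y t2\<bar> \<le> C * (t2 - t1)"
      using Q_locally_lipschitz_time[OF c(1), of a x y] by blast
    have "((\<lambda>r. Q x y r - Q x y t) \<longlongrightarrow> 0) (at t)"
    proof (rule Lim_null_comparison)
      have "((\<lambda>r. C * \<bar>r - t\<bar>) \<longlongrightarrow> C * \<bar>t - t\<bar>) (at t)" by (intro tendsto_intros)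
      then show "((\<lambda>r. C * \<bar>r - t\<bar>) \<longlongrightarrow> 0) (at t)" by simp
      have "norm (Q x y r - Q x y t) \<le> C * \<bar>r - t\<bar>" if "r \<in> {a<..<c}" "r \<noteq> t" for r
        using C[of r t] C[of t r] that c by (cases "r < t") (auto simp: abs_minus_commute)
      moreover have "\<forall>\<^sub>F r in at t. r \<in> {a<..<c}" using c by (intro eventually_at_in_open') auto
      moreover have "\<forall>\<^sub>F r in at t. r \<noteq> t" by (simp add: eventually_at_filter)
      ultimately show "\<forall>\<^sub>F r in at t. norm (Q x y r - Q x y t) \<le> C * \<bar>r - t\<bar>"
        by (smt (verit) eventually_elim2)
    qed
    then show ?thesis unfolding isCont_def by (simp add: LIM_zero_iff)
  qed
  then show ?thesis by (simp add: continuous_on_eq_continuous_at)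
qed

text \<open>Convexity in \<open>y\<close> and in \<open>x\<close> upgrades continuity in \<open>t\<close>, one variable at a time.\<close>

lemma Q_continuous: "continuous_on (UNIV \<times> UNIV \<times> {..<T}) (\<lambda>(x, y, t). Q x y t)"
proof -
  have yt: "continuous_on (UNIV \<times> {..<T}) (\<lambda>(y, t). Q x y t)" for x
    by (rule separately_convex_jointly_continuous) (auto intro: Q_convex_initial Q_continuous_time)
  have "continuous_on (UNIV \<times> (UNIV \<times> {..<T})) (\<lambda>(x, w). (\<lambda>(y, t). Q x y t) w)"
    by (rule separately_convex_jointly_continuous) (use yt in \<open>auto intro: Q_convex_terminal\<close>)
  then show ?thesis by simp
qed

lemma Qx_continuous: "continuous_on (UNIV \<times> UNIV \<times> {..<T}) (\<lambda>(x, y, t). Qx x y t)"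
proof -
  have "continuous_on (UNIV \<times> (UNIV \<times> {..<T})) (\<lambda>(x, w). (\<lambda>(y, t). Qx x y t) w)"
    by (rule convex_derivative_jointly_continuous[where f = "\<lambda>x (y, t). Q x y t"])
       (use Q_continuous in \<open>auto intro: Q_convex_terminal Q_has_derivative_terminal\<close>)
  then show ?thesis by simp
qed

lemma Qy_continuous: "continuous_on (UNIV \<times> UNIV \<times> {..<T}) (\<lambda>(x, y, t). Qy x y t)"
proof -
  have perm: "continuous_on (UNIV \<times> (UNIV \<times> {..<T})) (\<lambda>p. case p of (y, (x, t)) \<Rightarrow> f x y t)"
    if "continuous_on (UNIV \<times> (UNIV \<times> {..<T})) (\<lambda>p. case p of (x, (y, t)) \<Rightarrow> f x y t)"
    for f :: "real \<Rightarrow> real \<Rightarrow> real \<Rightarrow> real"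
  proof -
    have "continuous_on (UNIV \<times> (UNIV \<times> {..<T})) (\<lambda>p. (\<lambda>(x, (y, t)). f x y t) (fst (snd p), (fst p, snd (snd p))))"
      by (rule continuous_on_compose2[OF that]) (auto intro!: continuous_intros)
    then show ?thesis by (simp add: case_prod_beta)
  qed
  have "continuous_on (UNIV \<times> (UNIV \<times> {..<T})) (\<lambda>(y, w). (\<lambda>(x, t). Qy x y t) w)"
    by (rule convex_derivative_jointly_continuous[where f = "\<lambda>y (x, t). Q x y t"])
       (use perm[OF Q_continuous] in \<open>auto intro: Q_convex_initial Q_has_derivative_initial\<close>)
  then have "continuous_on (UNIV \<times> (UNIV \<times> {..<T})) (\<lambda>p. case p of (x, (y, t)) \<Rightarrow> Qy y x t)" by simp
  from perm[OF this] show ?thesis .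
qed

text \<open>The time derivative that the Hamilton-Jacobi equation prescribes.\<close>

definition Qt :: "real \<Rightarrow> real \<Rightarrow> real \<Rightarrow> real" where
  "Qt x y t = (Qy x y t)\<^sup>2 / 2 - b y t * Qy x y t"

lemma Qt_continuous: "continuous_on (UNIV \<times> UNIV \<times> {..<T}) (\<lambda>(x, y, t). Qt x y t)"
proof -
  have "continuous_on (UNIV \<times> UNIV \<times> {..<T}) (\<lambda>p. Qy (fst p) (fst (snd p)) (snd (snd p)))"
    using Qy_continuous by (simp add: case_prod_beta)
  then show ?thesis unfolding Qt_def case_prod_beta by (intro continuous_intros) auto
qed

text \<open>Let \<open>t1 < t2\<close> be \<open>r\<close> and \<open>t\<close> in increasing order. The quotient \<open>(Q(t1) - Q(t2)) / (t2 - t1)\<close> lies between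
  \<open>lo\<close>, from \<open>Q_ge_delayed_start\<close>, and \<open>up\<close>, from \<open>Q_le_delayed_start\<close> with the velocity
  \<open>v = b y t - m\<close> that minimizes the limit \<open>(v - b y t)\<^sup>2/2 + v m\<close> of \<open>up\<close>. Both limits are
  \<open>m b y t - m\<^sup>2/2\<close>.\<close>

lemma Q_has_derivative_time:
  assumes t: "t < T"
  shows "((\<lambda>t. Q x y t) has_real_derivative Qt x y t) (at t)"
proof -
  define m where "m = Qy x y t"
  define v where "v = b y t - m"
  define R where "R = 4 * (1/2 * integral {t - 1..t} (\<lambda>s. (b y s)\<^sup>2) + Q x y t) + 2 * integral {t - 1..T} (\<lambda>s. (b y s)\<^sup>2)"
  define E where "E = exp (A * (T - (t - 1)))"
  define quot where "quot = (\<lambda>r. (Q x y (min r t) - Q x y (max r t)) / \<bar>r - t\<bar>)"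
  define \<mu> where "\<mu> = (\<lambda>r. Qy x y (max r t))"
  define lo where "lo = (\<lambda>r. - (\<mu> r)\<^sup>2 / 2 + \<mu> r * (integral {min r t..max r t} (b y) / \<bar>r - t\<bar>)
     - \<bar>\<mu> r\<bar> * A * (sqrt (\<bar>r - t\<bar> * R) * E))"
  define up where "up = (\<lambda>r. integral {min r t..max r t} (\<lambda>s. 1/2 * (v - b (y + v * (s - min r t)) s)\<^sup>2) / \<bar>r - t\<bar>
     + v * Qy x (y + v * \<bar>r - t\<bar>) (max r t))"
  have near: "\<forall>\<^sub>F r in at t. r \<in> {t - 1<..<T}" using t by (intro eventually_at_in_open') auto
  have ne: "\<forall>\<^sub>F r in at t. r \<noteq> t" by (simp add: eventually_at_filter)
  have maxlim: "((\<lambda>r. max r t) \<longlongrightarrow> t) (at t)"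
    using tendsto_max[OF tendsto_ident_at[of t UNIV] tendsto_const[of t]] by simp
  have Qylim: "((\<lambda>r. Qy x (y + k * \<bar>r - t\<bar>) (max r t)) \<longlongrightarrow> m) (at t)" for k
  proof -
    have "((\<lambda>r. y + k * \<bar>r - t\<bar>) \<longlongrightarrow> y + k * \<bar>t - t\<bar>) (at t)" by (intro tendsto_intros)
    then have "((\<lambda>r. (x, y + k * \<bar>r - t\<bar>, max r t)) \<longlongrightarrow> (x, y, t)) (at t)"
      by (intro tendsto_Pair tendsto_const maxlim) simp
    moreover have "\<forall>\<^sub>F r in at t. (x, y + k * \<bar>r - t\<bar>, max r t) \<in> UNIV \<times> UNIV \<times> {..<T}"
      using near by eventually_elim (use t in auto)
    ultimately show ?thesis
      using continuous_on_tendsto_compose[OF Qy_continuous, of "\<lambda>r. (x, y + k * \<bar>r - t\<bar>, max r t)" "(x, y, t)" "at t"] t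
      by (simp add: m_def)
  qed
  have mulim: "(\<mu> \<longlongrightarrow> m) (at t)" using Qylim[of 0] by (simp add: \<mu>_def)
  have avg_b: "((\<lambda>r. integral {min r t..max r t} (b y) / \<bar>r - t\<bar>) \<longlongrightarrow> b y t) (at t)"
    by (rule interval_average_tendsto[where G = "\<lambda>s \<tau>. b y s", OF _ t])
       (auto simp: case_prod_beta intro!: continuous_intros)
  have avg_v: "((\<lambda>r. integral {min r t..max r t} (\<lambda>s. 1/2 * (v - b (y + v * (s - min r t)) s)\<^sup>2) / \<bar>r - t\<bar>)
      \<longlongrightarrow> 1/2 * (v - b (y + v * (t - t)) t)\<^sup>2) (at t)"
    by (rule interval_average_tendsto[where G = "\<lambda>s \<tau>. 1/2 * (v - b (y + v * (s - \<tau>)) s)\<^sup>2", OF _ t])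
       (auto simp: case_prod_beta intro!: continuous_intros)
  have "((\<lambda>r. sqrt (\<bar>r - t\<bar> * R)) \<longlongrightarrow> sqrt (\<bar>t - t\<bar> * R)) (at t)" by (intro tendsto_intros)
  then have "(lo \<longlongrightarrow> - m\<^sup>2 / 2 + m * b y t - \<bar>m\<bar> * A * (0 * E)) (at t)"
    unfolding lo_def by (intro tendsto_intros mulim avg_b) simp_all
  then have lo: "(lo \<longlongrightarrow> - Qt x y t) (at t)" by (simp add: Qt_def m_def mult.commute)
  have "(up \<longlongrightarrow> 1/2 * (v - b (y + v * (t - t)) t)\<^sup>2 + v * m) (at t)"
    unfolding up_def by (intro tendsto_add[OF avg_v] tendsto_intros Qylim)
  moreover have "1/2 * (v - b (y + v * (t - t)) t)\<^sup>2 + v * m = - Qt x y t"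
    by (simp add: v_def Qt_def m_def[symmetric] power2_eq_square algebra_simps)
  ultimately have up: "(up \<longlongrightarrow> - Qt x y t) (at t)" by simp
  have bounds: "lo r \<le> quot r \<and> quot r \<le> up r" if r: "r \<in> {t - 1<..<T}" "r \<noteq> t" for r
  proof -
    define t1 t2 h where "t1 = min r t" and "t2 = max r t" and "h = \<bar>r - t\<bar>"
    have tt: "t1 < t2" "t2 < T" "t2 - t1 = h" "h > 0" "t - 1 \<le> t1" "t1 \<le> t"
      using r t by (auto simp: t1_def t2_def h_def)
    have cb2: "continuous_on {t - 1..T} (\<lambda>s. (b y s)\<^sup>2)" by (intro continuous_intros) auto
    have "integral {t1..T} (\<lambda>s. (b y s)\<^sup>2) \<le> integral {t - 1..T} (\<lambda>s. (b y s)\<^sup>2)"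
      using tt by (intro integral_subset_le integrable_continuous_real continuous_on_subset[OF cb2] cb2) auto
    then have R1: "4 * Q x y t1 + 2 * integral {t1..T} (\<lambda>s. (b y s)\<^sup>2) \<le> R"
      unfolding R_def using Q_bounded_earlier[OF tt(5,6) t, of x y] by simp
    have E1: "exp (A * (T - t1)) \<le> E" unfolding E_def using A_nonneg tt by (simp add: mult_left_mono)
    have "lo r * h = - (\<mu> r)\<^sup>2 / 2 * h + \<mu> r * integral {t1..t2} (b y) - \<bar>\<mu> r\<bar> * A * (sqrt (h * R) * E) * h"
      using tt(4) unfolding lo_def t1_def[symmetric] t2_def[symmetric] h_def[symmetric]
      by (simp add: distrib_right left_diff_distrib)
    then have "lo r * h \<le> Q x y t1 - Q x y t2"
      using Q_ge_delayed_start[OF tt(1,2) R1 E1] unfolding tt(3) \<mu>_def t2_def[symmetric] by simp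
    then have 1: "lo r \<le> quot r"
      using tt(4) unfolding quot_def t1_def[symmetric] t2_def[symmetric] h_def[symmetric] by (simp add: pos_le_divide_eq)
    have "Q x y t1 \<le> 1/2 * integral {t1..t2} (\<lambda>s. (v - b (y + v * (s - t1)) s)\<^sup>2) + Q x (y + v * h) t2"
      using Q_le_delayed_start[OF tt(1,2), of x y v] unfolding tt(3) .
    moreover have "Q x (y + v * h) t2 + Qy x (y + v * h) t2 * (y - (y + v * h)) \<le> Q x y t2"
      by (rule Q_above_tangent[OF tt(2)])
    moreover have "up r * h = 1/2 * integral {t1..t2} (\<lambda>s. (v - b (y + v * (s - t1)) s)\<^sup>2) + v * Qy x (y + v * h) t2 * h"
      using tt(4) unfolding up_def t1_def[symmetric] t2_def[symmetric] h_def[symmetric]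
      by (simp add: distrib_right)
    ultimately have "Q x y t1 - Q x y t2 \<le> up r * h" by (simp add: algebra_simps)
    then have "quot r \<le> up r"
      using tt(4) unfolding quot_def t1_def[symmetric] t2_def[symmetric] h_def[symmetric] by (simp add: pos_divide_le_eq)
    with 1 show ?thesis by simp
  qed
  have "(quot \<longlongrightarrow> - Qt x y t) (at t)"
  proof (rule tendsto_sandwich[OF _ _ lo up])
    show "\<forall>\<^sub>F r in at t. lo r \<le> quot r" using near ne by eventually_elim (use bounds in blast)
    show "\<forall>\<^sub>F r in at t. quot r \<le> up r" using near ne by eventually_elim (use bounds in blast)
  qed
  then have "((\<lambda>r. - quot r) \<longlongrightarrow> Qt x y t) (at t)" using tendsto_minus by fastforce
  moreover have "- quot r = (Q x y r - Q x y t) / (r - t)" if "r \<noteq> t" for r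
    using that unfolding quot_def by (cases "r < t") (auto simp: min_def max_def field_simps abs_if)
  ultimately have "((\<lambda>r. (Q x y r - Q x y t) / (r - t)) \<longlongrightarrow> Qt x y t) (at t)"
    by (subst (asm) tendsto_cong[OF eventually_mono[OF ne]]) auto
  then show ?thesis by (simp add: has_field_derivative_iff)
qed

text \<open>Partial derivatives that are continuous assemble to a derivative. The coordinates are regrouped as
  \<open>((y, t), x)\<close>, so that in each of the two steps a real partial derivative is the continuous one.\<close>

theorem Q_C1: "C1_on (UNIV \<times> UNIV \<times> {..<T}) (\<lambda>(x, y, t). Q x y t)"
proof -
  let ?S = "UNIV \<times> UNIV \<times> {..<T} :: (real \<times> real \<times> real) set"
  define Lx Ly Lt :: "(real \<times> real \<times> real) \<Rightarrow>\<^sub>L real"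
    where "Lx = Blinfun fst" and "Ly = Blinfun (fst \<circ> snd)" and "Lt = Blinfun (snd \<circ> snd)"
  have L: "blinfun_apply Lx = fst" "blinfun_apply Ly = fst \<circ> snd" "blinfun_apply Lt = snd \<circ> snd"
    unfolding Lx_def Ly_def Lt_def
    by (auto intro!: bounded_linear_Blinfun_apply bounded_linear_fst bounded_linear_snd
      bounded_linear_compose[OF bounded_linear_fst bounded_linear_snd]
      bounded_linear_compose[OF bounded_linear_snd bounded_linear_snd] simp: o_def)
  define F where "F = (\<lambda>p::real \<times> real \<times> real. case p of (x, y, t) \<Rightarrow>
     Qx x y t *\<^sub>R Lx + Qy x y t *\<^sub>R Ly + Qt x y t *\<^sub>R Lt)"
  have "continuous_on ?S F"
  proof -
    have "F = (\<lambda>p. (\<lambda>(x, y, t). Qx x y t) p *\<^sub>R Lx + (\<lambda>(x, y, t). Qy x y t) p *\<^sub>R Ly + (\<lambda>(x, y, t). Qt x y t) p *\<^sub>R Lt)"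
      by (auto simp: F_def)
    then show ?thesis
      by (simp only:) (intro continuous_on_add continuous_on_scaleR Qx_continuous Qy_continuous Qt_continuous continuous_on_const)
  qed
  moreover have "((\<lambda>(x, y, t). Q x y t) has_derivative blinfun_apply (F p)) (at p)" if "p \<in> ?S" for p
  proof -
    obtain x y t where p: "p = (x, y, t)" and t: "t < T" using \<open>p \<in> ?S\<close> by auto
    let ?W = "UNIV \<times> {..<T} :: (real \<times> real) set"
    have sub: "continuous_on U (\<lambda>q. f (X q) (Y q) (Z q))"
      if "continuous_on ?S (\<lambda>(x, y, t). f x y t)" "continuous_on U X" "continuous_on U Y" "continuous_on U Z"
        "\<And>q. q \<in> U \<Longrightarrow> Z q < T"
      for f :: "real \<Rightarrow> real \<Rightarrow> real \<Rightarrow> real" and U :: "('c::topological_space) set" and X Y Z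
    proof -
      have "continuous_on U (\<lambda>q. (\<lambda>(x, y, t). f x y t) (X q, Y q, Z q))"
        by (rule continuous_on_compose2[OF that(1)]) (use that(5) in \<open>auto intro!: continuous_intros that(2-4)\<close>)
      then show ?thesis by simp
    qed
    have open_pts: "(y, t) \<in> ?W" "((y, t), x) \<in> ?W \<times> UNIV" using t by auto
    have yt: "((\<lambda>(y, t). Q x y t) has_derivative (\<lambda>(hy, ht). Qy x y t * hy + blinfun_apply (Qt x y t *\<^sub>R id_blinfun) ht))
       (at (y, t) within ?W)"
    proof (rule has_derivative_partialsI)
      show "((\<lambda>y. Q x y t) has_derivative (*) (Qy x y t)) (at y within UNIV)"
        using Q_has_derivative_initial[OF t] by (simp add: has_field_derivative_def)
      fix y' t' assume "t' \<in> {..<T}"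
      then show "((\<lambda>t. Q x y' t) has_derivative blinfun_apply (Qt x y' t' *\<^sub>R id_blinfun)) (at t' within {..<T})"
        using Q_has_derivative_time[of t' x y', THEN has_field_derivative_at_within, of "{..<T}"]
        by (simp add: has_field_derivative_def scaleR_blinfun.rep_eq)
    next
      have "continuous_on ?W (\<lambda>q. Qt x (fst q) (snd q) *\<^sub>R (id_blinfun :: real \<Rightarrow>\<^sub>L real))"
        by (intro continuous_intros sub[OF Qt_continuous]) auto
      then show "continuous (at (y, t) within ?W) (\<lambda>(y, t). Qt x y t *\<^sub>R (id_blinfun :: real \<Rightarrow>\<^sub>L real))"
        unfolding continuous_on_eq_continuous_within case_prod_beta using open_pts(1) by blast
    qed (use t in auto)
    let ?D = "\<lambda>(hy, ht). Qy x y t * hy + blinfun_apply (Qt x y t *\<^sub>R id_blinfun) ht"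
    have wx: "((\<lambda>(w, x). Q x (fst w) (snd w)) has_derivative
       (\<lambda>(hw, hx). ?D hw + blinfun_apply (Qx x (fst (y, t)) (snd (y, t)) *\<^sub>R id_blinfun) hx))
       (at ((y, t), x) within ?W \<times> UNIV)"
    proof (rule has_derivative_partialsI[where fx = ?D and fy = "\<lambda>w x. Qx x (fst w) (snd w) *\<^sub>R id_blinfun"])
      show "((\<lambda>w. Q x (fst w) (snd w)) has_derivative (\<lambda>(hy, ht). Qy x y t * hy + blinfun_apply (Qt x y t *\<^sub>R id_blinfun) ht)) (at (y, t) within ?W)"
      proof -
        have "(\<lambda>w. Q x (fst w) (snd w)) = (\<lambda>(y, t). Q x y t)" by auto
        then show ?thesis using yt by (simp only:)
      qed
      fix w x' assume "w \<in> ?W"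
      then show "((\<lambda>x. Q x (fst w) (snd w)) has_derivative blinfun_apply (Qx x' (fst w) (snd w) *\<^sub>R id_blinfun)) (at x' within UNIV)"
        using Q_has_derivative_terminal[of "snd w" "fst w" x'] by (auto simp: has_field_derivative_def scaleR_blinfun.rep_eq)
    next
      have "continuous_on (?W \<times> UNIV) (\<lambda>q. Qx (snd q) (fst (fst q)) (snd (fst q)) *\<^sub>R (id_blinfun :: real \<Rightarrow>\<^sub>L real))"
        by (intro continuous_intros sub[OF Qx_continuous]) auto
      then show "continuous (at ((y, t), x) within ?W \<times> UNIV) (\<lambda>(w, x). Qx x (fst w) (snd w) *\<^sub>R (id_blinfun :: real \<Rightarrow>\<^sub>L real))"
        unfolding continuous_on_eq_continuous_within case_prod_beta using open_pts(2) by blast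
    qed auto
    have "open (?W \<times> (UNIV :: real set))" by (intro open_Times) auto
    from wx at_within_open[OF open_pts(2) this]
    have wx': "((\<lambda>(w, x). Q x (fst w) (snd w)) has_derivative
       (\<lambda>(hw, hx). ?D hw + blinfun_apply (Qx x y t *\<^sub>R id_blinfun) hx))
       (at ((\<lambda>p. (snd p, fst p)) (x, y, t)))" by simp
    have swap: "((\<lambda>p::real \<times> real \<times> real. (snd p, fst p)) has_derivative (\<lambda>h. (snd h, fst h))) (at (x, y, t))"
      by (intro derivative_intros)
    have "(\<lambda>q. (\<lambda>(w, x). Q x (fst w) (snd w)) (snd q, fst q)) = (\<lambda>(x, y, t). Q x y t)" by auto
    moreover have "(\<lambda>h. (\<lambda>(hw, hx). ?D hw + blinfun_apply (Qx x y t *\<^sub>R id_blinfun) hx) (snd h, fst h))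
        = blinfun_apply (F p)"
      by (auto simp: F_def p L plus_blinfun.rep_eq scaleR_blinfun.rep_eq)
    ultimately show ?thesis
      using has_derivative_compose[OF swap wx'] unfolding p by (simp only:)
  qed
  ultimately show ?thesis unfolding C1_on_def by blast
qed

end

theorem proposition2p2:
  fixes T A :: real and b b\<^sub>y :: "real \<Rightarrow> real \<Rightarrow> real"
  assumes "T > 0" and "A \<ge> 0"
    and "continuous_on (UNIV \<times> {..T}) (\<lambda>(y, s). b y s)"
    and "\<And>y s. s \<le> T \<Longrightarrow> ((\<lambda>z. b z s) has_real_derivative b\<^sub>y y s) (at y)"
    and "continuous_on (UNIV \<times> {..T}) (\<lambda>(y, s). b\<^sub>y y s)"
    and "\<And>y s. s \<le> T \<Longrightarrow> \<bar>b\<^sub>y y s\<bar> \<le> A"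
  shows "(\<forall>t<T. (\<forall>s\<in>{t..T}. concave_on UNIV (\<lambda>y. b y s)) \<longrightarrow>
            (\<forall>x y. \<exists>!\<gamma>. is_minimizer b T x y t \<gamma>))
       \<and> ((\<forall>t<T. \<forall>s\<in>{t..T}. concave_on UNIV (\<lambda>y. b y s)) \<longrightarrow>
            C1_on (UNIV \<times> UNIV \<times> {..<T}) (\<lambda>(x, y, t). q b T x y t))"
proof -
  have lip: "\<bar>b y s - b z s\<bar> \<le> A * \<bar>y - z\<bar>" if "s \<le> T" for y z s
    using field_differentiable_bound[of UNIV "\<lambda>z. b z s" "\<lambda>y. b\<^sub>y y s" A y z] assms(4,6)[OF that]
    by (simp add: has_field_derivative_at_within)
  interpret lipschitz_drift T A b
    using assms(2,3) lip by unfold_locales auto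
  show ?thesis
  proof (intro conjI allI impI)
    fix t x y assume "t < T" "\<forall>s\<in>{t..T}. concave_on UNIV (\<lambda>y. b y s)"
    then show "\<exists>!\<gamma>. is_minimizer b T x y t \<gamma>" by (intro minimizer_unique) auto
  next
    assume conc: "\<forall>t<T. \<forall>s\<in>{t..T}. concave_on UNIV (\<lambda>y. b y s)"
    \<comment> \<open>The hypothesis speaks of \<open>s\<close> through intervals with left end below \<open>T\<close>; \<open>s - 1\<close> is such an end even if \<open>s = T\<close>.\<close>
    have "concave_on UNIV (\<lambda>y. b y s)" if "s \<le> T" for s
    proof -
      have "s - 1 < T" "s \<in> {s - 1..T}" using that by auto
      then show ?thesis using conc by blast
    qed
    then interpret concave_drift T A b b\<^sub>y
      using assms(4) by unfold_locales auto
    show "C1_on (UNIV \<times> UNIV \<times> {..<T}) (\<lambda>(x, y, t). q b T x y t)" by (rule Q_C1)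
  qed
qed

end
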